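(* There exists an algorithm that, given a set $P$ of $n$ points in the plane and an arbitrary convex polygon $C$ with $m$ vertices given as a sorted array, generates in $O(n\log n+mn)$ time a set of translations of $C$ that covers all points in $P$ and has ply at most $4$.
   Context: A translation of $C$ is a set $C+v=\{x+v:x\in C\}$ with $v\in\mathbb{R}^2$. For a set $\mathcal{S}$ of geometric objects in the plane, its ply is $\mathsf{ply}(\mathcal{S})=\max_{p\in\mathbb{R}^2}|\{s\in\mathcal{S}: p\in s\}|$. The set $\mathcal{S}$ covers $P$ if its union contains $P$. Polygons are closed regions. *)

theory Defs
  imports "HOL-Analysis.Analysis"
begin

section \<open>Real RAM\<close>

text \<open>
  A structured real RAM with finitely many named, unbounded arrays of natural numbers and of
  reals; a scalar variable is cell 0 of an array. Natural numbers serve for counting and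
  indexing and have only addition and truncated subtraction. Reals have exact field operations
  and comparison. There is no rounding and no conversion from reals to natural numbers, and the
  only constants are integers, so neither a constant nor a unit-cost operation can smuggle in
  extra computing power.
\<close>

datatype nexp =
    NConst nat
  | NRead string nexp
  | NAdd nexp nexp
  | NSub nexp nexp

datatype rexp =
    RConst int
  | RRead string nexp
  | RAdd rexp rexp
  | RSub rexp rexp
  | RMul rexp rexp
  | RDiv rexp rexp

datatype bexp =
    NLess nexp nexp
  | RLess rexp rexp
  | BNot bexp
  | BAnd bexp bexp

datatype com =
    Skip
  | NWrite string nexp nexp
  | RWrite string nexp rexp
  | Seq com com
  | Cond bexp com com
  | While bexp com

record state =
  nmem :: "string \<Rightarrow> nat \<Rightarrow> nat"
  rmem :: "string \<Rightarrow> nat \<Rightarrow> real"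

primrec nval :: "nexp \<Rightarrow> state \<Rightarrow> nat" where
  "nval (NConst k) s = k"
| "nval (NRead a i) s = nmem s a (nval i s)"
| "nval (NAdd e f) s = nval e s + nval f s"
| "nval (NSub e f) s = nval e s - nval f s"

primrec rval :: "rexp \<Rightarrow> state \<Rightarrow> real" where
  "rval (RConst k) s = of_int k"
| "rval (RRead a i) s = rmem s a (nval i s)"
| "rval (RAdd e f) s = rval e s + rval f s"
| "rval (RSub e f) s = rval e s - rval f s"
| "rval (RMul e f) s = rval e s * rval f s"
| "rval (RDiv e f) s = rval e s / rval f s"

primrec bval :: "bexp \<Rightarrow> state \<Rightarrow> bool" where
  "bval (NLess e f) s = (nval e s < nval f s)"
| "bval (RLess e f) s = (rval e s < rval f s)"
| "bval (BNot b) s = (\<not> bval b s)"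
| "bval (BAnd b c) s = (bval b s \<and> bval c s)"

text \<open>Every constant, memory access, arithmetic operation, comparison and connective costs 1.\<close>

primrec ncost :: "nexp \<Rightarrow> nat" where
  "ncost (NConst k) = 1"
| "ncost (NRead a i) = 1 + ncost i"
| "ncost (NAdd e f) = 1 + ncost e + ncost f"
| "ncost (NSub e f) = 1 + ncost e + ncost f"

primrec rcost :: "rexp \<Rightarrow> nat" where
  "rcost (RConst k) = 1"
| "rcost (RRead a i) = 1 + ncost i"
| "rcost (RAdd e f) = 1 + rcost e + rcost f"
| "rcost (RSub e f) = 1 + rcost e + rcost f"
| "rcost (RMul e f) = 1 + rcost e + rcost f"
| "rcost (RDiv e f) = 1 + rcost e + rcost f"

primrec bcost :: "bexp \<Rightarrow> nat" where
  "bcost (NLess e f) = 1 + ncost e + ncost f"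
| "bcost (RLess e f) = 1 + rcost e + rcost f"
| "bcost (BNot b) = 1 + bcost b"
| "bcost (BAnd b c) = 1 + bcost b + bcost c"

definition nwrite :: "string \<Rightarrow> nat \<Rightarrow> nat \<Rightarrow> state \<Rightarrow> state" where
  "nwrite a i k s = s\<lparr>nmem := (nmem s)(a := (nmem s a)(i := k))\<rparr>"

definition rwrite :: "string \<Rightarrow> nat \<Rightarrow> real \<Rightarrow> state \<Rightarrow> state" where
  "rwrite a i x s = s\<lparr>rmem := (rmem s)(a := (rmem s a)(i := x))\<rparr>"

text \<open>
  \<open>exec c s t s'\<close>: started in \<open>s\<close>, the program \<open>c\<close> halts after \<open>t\<close> steps in \<open>s'\<close>. The relation
  is deterministic, and a diverging run has no \<open>t\<close> and \<open>s'\<close>.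
\<close>

inductive exec :: "com \<Rightarrow> state \<Rightarrow> nat \<Rightarrow> state \<Rightarrow> bool" where
  Skip: "exec Skip s 1 s"
| NWrite: "exec (NWrite a i e) s (1 + ncost i + ncost e) (nwrite a (nval i s) (nval e s) s)"
| RWrite: "exec (RWrite a i e) s (1 + ncost i + rcost e) (rwrite a (nval i s) (rval e s) s)"
| Seq: "exec c s t s' \<Longrightarrow> exec d s' u s'' \<Longrightarrow> exec (Seq c d) s (t + u) s''"
| CondTrue: "bval b s \<Longrightarrow> exec c s t s' \<Longrightarrow> exec (Cond b c d) s (1 + bcost b + t) s'"
| CondFalse: "\<not> bval b s \<Longrightarrow> exec d s t s' \<Longrightarrow> exec (Cond b c d) s (1 + bcost b + t) s'"
| WhileFalse: "\<not> bval b s \<Longrightarrow> exec (While b c) s (1 + bcost b) s"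
| WhileTrue: "bval b s \<Longrightarrow> exec c s t s' \<Longrightarrow> exec (While b c) s' u s'' \<Longrightarrow>
    exec (While b c) s (1 + bcost b + t + u) s''"


section \<open>Polygons, translations and ply\<close>

type_synonym point = "real \<times> real"

text \<open>
  The closed region bounded by a convex polygon whose vertices are listed in order along its
  boundary, clockwise or counterclockwise: cyclically consecutive entries span the edges. The
  vertices are exactly the corners of the region; none lies in the interior of an edge.
\<close>

definition convex_polygon :: "point list \<Rightarrow> point set \<Rightarrow> bool" where
  "convex_polygon vs C \<longleftrightarrow>
     3 \<le> length vs \<and> distinct vs \<and> C = convex hull (set vs) \<and>
     set vs = {v. v extreme_point_of C} \<and>
     (\<forall>i < length vs. closed_segment (vs ! i) (vs ! ((i + 1) mod length vs)) edge_of C)"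

definition translation :: "point set \<Rightarrow> point \<Rightarrow> point set" where
  "translation C v = {x + v | x. x \<in> C}"

text \<open>The maximum exists for finite \<open>S\<close>, the only case in which the value is meaningful.\<close>

definition ply :: "point set set \<Rightarrow> nat" where
  "ply S = Max {card {s \<in> S. p \<in> s} | p. True}"

definition covers :: "point set set \<Rightarrow> point set \<Rightarrow> bool" where
  "covers S P \<longleftrightarrow> P \<subseteq> \<Union> S"


section \<open>Input and output conventions\<close>

text \<open>
  Points are passed as a coordinate array each for x and y, together with the number of points.
  All cells not occupied by the input are 0. An output translation of the polygon is represented
  by its translation vector.
\<close>

definition array_of :: "real list \<Rightarrow> nat \<Rightarrow> real" where
  "array_of xs i = (if i < length xs then xs ! i else 0)"

definition input_state :: "point list \<Rightarrow> point list \<Rightarrow> state" where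
  "input_state ps vs =
     \<lparr>nmem = (\<lambda>_ _. 0)(''n'' := (\<lambda>_. 0)(0 := length ps), ''m'' := (\<lambda>_. 0)(0 := length vs)),
      rmem = (\<lambda>_ _. 0)(''px'' := array_of (map fst ps), ''py'' := array_of (map snd ps),
                       ''vx'' := array_of (map fst vs), ''vy'' := array_of (map snd vs))\<rparr>"

definition output_vectors :: "state \<Rightarrow> point set" where
  "output_vectors s = {(rmem s ''ox'' i, rmem s ''oy'' i) | i. i < nmem s ''k'' 0}"

end

theory Submission
  imports Defs
begin

text \<open>
  Let \<open>l\<close> and \<open>r\<close> be a leftmost and a rightmost vertex, \<open>u = r - l\<close>, let \<open>a\<close> and \<open>t\<close> be vertices at
  which \<open>cross u\<close> is minimal and maximal, \<open>d = t - a\<close> and \<open>D = cross u d > 0\<close>. Since \<open>l\<close> and \<open>r\<close> lie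
  on parallel supporting lines, no chord of \<open>C\<close> parallel to \<open>u\<close> is longer than \<open>u\<close>; and the
  midpoints of the sides of the quadrilateral \<open>l a r t\<close> form a parallelogram inside \<open>C\<close> with sides
  \<open>u / 2\<close> and \<open>d / 2\<close>. In the linear coordinates \<open>(cross u p, cross p d)\<close> this parallelogram is a
  \<open>D / 2\<close> by \<open>D / 2\<close> square.

  Sort the points by the first coordinate and cut greedily into strips of height \<open>D / 2\<close>, then
  inside every strip sort by the second coordinate and cover greedily by squares of width \<open>D / 2\<close>.
  Consecutive strip bases, and consecutive squares of a strip, are more than \<open>D / 2\<close> apart. A
  point lies only in translates whose strip bases are in an interval of length \<open>D\<close>, so there are at
  most two strips, and for each of them, by the bound on the chords, the squares start in an interval
  of length \<open>D\<close>, so there are at most two translates.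

  Choosing the vectors takes time \<open>O(m)\<close>, sorting \<open>O(n log n)\<close>, everything else \<open>O(n)\<close>.
\<close>

section \<open>Geometry\<close>

definition cross :: "point \<Rightarrow> point \<Rightarrow> real" where
  "cross x y = fst x * snd y - snd x * fst y"

lemma cross_simps:
  "cross x (y + z) = cross x y + cross x z" "cross (x + y) z = cross x z + cross y z"
  "cross x (y - z) = cross x y - cross x z" "cross (x - y) z = cross x z - cross y z"
  "cross x (r *\<^sub>R y) = r * cross x y" "cross (r *\<^sub>R x) y = r * cross x y" "cross x x = 0"
  by (auto simp: cross_def algebra_simps)

text \<open>Cramer's rule: \<open>cross u d *\<^sub>R z = cross z d *\<^sub>R u + cross u z
  *\<^sub>R d\<close> holds for any three plane vectors.\<close>

lemma cross_basis:
  assumes "cross u d \<noteq> 0"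
  shows "z = (cross z d / cross u d) *\<^sub>R u + (cross u z / cross u d) *\<^sub>R d"
proof -
  have "cross u d *\<^sub>R z = cross z d *\<^sub>R u + cross u z *\<^sub>R d"
    by (cases z; cases u; cases d) (simp add: cross_def algebra_simps)
  then have "(1 / cross u d) *\<^sub>R cross u d *\<^sub>R z = (1 / cross u d) *\<^sub>R (cross z d *\<^sub>R u + cross u z *\<^sub>R d)"
    by simp
  with assms show ?thesis by (simp add: scaleR_add_right)
qed

text \<open>Half-spaces are convex, so linear bounds checked at the vertices pass to the whole
  polygon.\<close>

lemma hull_bounds:
  assumes "\<And>x. x \<in> S \<Longrightarrow> lo \<le> inner a x \<and> inner a x \<le> hi" "c \<in> convex hull S"
  shows "lo \<le> inner a c \<and> inner a c \<le> hi"
proof -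
  have "convex hull S \<subseteq> {x. lo \<le> inner a x} \<inter> {x. inner a x \<le> hi}"
    using assms(1) by (intro hull_minimal convex_Int convex_halfspace_le convex_halfspace_ge) auto
  with assms(2) show ?thesis by auto
qed

text \<open>Of three distinct collinear points one lies strictly between the other two, which an
  extreme point cannot do.\<close>

lemma not_collinear_extreme:
  assumes "x extreme_point_of C" "y extreme_point_of C" "z extreme_point_of C" "distinct [x, y, z]"
  shows "\<not> collinear {x, y, z :: 'a :: euclidean_space}"
proof
  assume "collinear {x, y, z}"
  then have "x \<in> open_segment y z \<or> y \<in> open_segment z x \<or> z \<in> open_segment x y"
    using assms(4) by (auto simp: collinear_between_cases between_mem_segment open_segment_def)
  with assms show False
    unfolding extreme_point_of_def by blast
qed

lemma collinear_level:
  assumes "u \<noteq> 0" "\<And>x. x \<in> S \<Longrightarrow> cross u x = c"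
  shows "collinear S"
  unfolding collinear_def
proof (intro exI[of _ u] ballI)
  fix x y assume "x \<in> S" "y \<in> S"
  with assms have "cross u (x - y) = 0" by (simp add: cross_simps)
  with assms(1) show "\<exists>c. x - y = c *\<^sub>R u"
  \<comment> \<open>The factor is found by dividing by whichever coordinate of \<open>u\<close> is
    nonzero.\<close>
  proof (cases "fst u = 0")
    case True
    with assms(1) have "snd u \<noteq> 0" by (simp add: prod_eq_iff)
    with True \<open>cross u (x - y) = 0\<close> show ?thesis
      by (intro exI[of _ "snd (x - y) / snd u"]) (auto simp: cross_def prod_eq_iff)
  next
    case False
    with \<open>cross u (x - y) = 0\<close> show ?thesis
      by (intro exI[of _ "fst (x - y) / fst u"]) (auto simp: cross_def prod_eq_iff field_simps)
  qed
qed

text \<open>Moves the point \<open>c\<close>, the lower corner of the inscribed parallelogram, to coordinates \<open>q\<close>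
  with respect to \<open>(cross u p, cross p d)\<close>, provided \<open>D = cross u d\<close>.\<close>

definition vec :: "point \<Rightarrow> point \<Rightarrow> point \<Rightarrow> real \<Rightarrow> real \<times> real \<Rightarrow> point" where
  "vec u d c D q = (snd q / D) *\<^sub>R u + (fst q / D) *\<^sub>R d - c"

section \<open>Translates of the polygon in linear coordinates\<close>

lemma mem_translationI: "p - v \<in> C \<Longrightarrow> p \<in> translation C v"
  unfolding translation_def by (rule CollectI, rule exI[of _ "p - v"]) simp

text \<open>Midpoints between a point of the segment \<open>a q\<close> and a point of the segment
  \<open>s t\<close> lie in \<open>C\<close> by convexity and sweep out the inscribed parallelogram.
  In the application \<open>a\<close>, \<open>q\<close> are the leftmost and rightmost vertices, and
  \<open>s\<close>, \<open>t\<close> the extreme vertices for \<open>cross (q - a)\<close>.\<close>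

lemma mem_translation_vec:
  assumes C: "convex C" "a \<in> C" "q \<in> C" "s \<in> C" "t \<in> C"
    and D: "0 < cross (q - a) (t - s)"
    and B: "B \<le> cross (q - a) p" "cross (q - a) p \<le> B + cross (q - a) (t - s) / 2"
    and G: "G \<le> cross p (t - s)" "cross p (t - s) \<le> G + cross (q - a) (t - s) / 2"
  shows "p \<in> translation C (vec (q - a) (t - s) ((1 / 2) *\<^sub>R (a + s)) (cross (q - a) (t - s)) (B, G))"
proof -
  define u d where "u = q - a" and "d = t - s"
  define D where "D = cross u d"
  have D: "0 < D" using D by (simp add: D_def u_def d_def)
  \<comment> \<open>\<open>p\<close> minus the translation vector will be the midpoint of the points
    at parameters \<open>l\<close> and \<open>m\<close> on the two segments; the factor 2 makes up
    for the halving in that midpoint.\<close>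
  define l where "l = 2 * (cross p d - G) / D"
  define m where "m = 2 * (cross u p - B) / D"
  have l: "0 \<le> l" "l \<le> 1" and m: "0 \<le> m" "m \<le> 1"
    using B G D unfolding l_def m_def D_def u_def d_def by (auto simp: field_simps)
  have 1: "(1 - l) *\<^sub>R a + l *\<^sub>R q \<in> C" "(1 - m) *\<^sub>R s + m *\<^sub>R t \<in> C"
    using C l m by (auto intro!: convexD)
  have "(1 / 2) *\<^sub>R ((1 - l) *\<^sub>R a + l *\<^sub>R q) + (1 / 2) *\<^sub>R ((1 - m) *\<^sub>R s + m *\<^sub>R t) \<in> C"
    using convexD[OF C(1) 1, of "1/2" "1/2"] by simp
  also have "(1 / 2) *\<^sub>R ((1 - l) *\<^sub>R a + l *\<^sub>R q) + (1 / 2) *\<^sub>R ((1 - m) *\<^sub>R s + m *\<^sub>R t)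
      = (l / 2) *\<^sub>R u + (m / 2) *\<^sub>R d + (1 / 2) *\<^sub>R (a + s)"
    by (simp add: u_def d_def algebra_simps)
  also have "\<dots> = (cross p d / D) *\<^sub>R u + (cross u p / D) *\<^sub>R d - vec u d ((1 / 2) *\<^sub>R (a + s)) D (B, G)"
    by (simp add: l_def m_def vec_def scaleR_diff_left diff_divide_distrib)
  also have "(cross p d / D) *\<^sub>R u + (cross u p / D) *\<^sub>R d = p"
    using cross_basis[of u d p] D by (simp add: D_def)
  finally show ?thesis
    unfolding u_def d_def D_def by (rule mem_translationI)
qed

text \<open>The two points of \<open>C\<close> that are moved to \<open>z\<close> differ by the
  difference of the vectors. Applying \<open>cross u\<close> isolates the first coordinate, as
  \<open>cross u u = 0\<close>. If the first coordinates agree, the difference is a multiple of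
  \<open>u\<close> with horizontal extent at most that of \<open>u\<close>, which is the chord
  bound.\<close>

lemma translation_vec_close:
  assumes z: "z \<in> translation C (vec u d c (cross u d) x)" "z \<in> translation C (vec u d c (cross u d) y)"
    and D: "0 < cross u d" and u: "0 < fst u"
    and beta: "\<And>v w. v \<in> C \<Longrightarrow> w \<in> C \<Longrightarrow> cross u v - cross u w \<le> cross u d"
    and width: "\<And>v w. v \<in> C \<Longrightarrow> w \<in> C \<Longrightarrow> fst v - fst w \<le> fst u"
  shows "fst x - fst y \<le> cross u d \<and> (fst x = fst y \<longrightarrow> snd x - snd y \<le> cross u d)"
proof -
  define D where "D = cross u d"
  from z obtain v w where vw: "v \<in> C" "w \<in> C" "z = v + vec u d c D x" "z = w + vec u d c D y"
    by (auto simp: translation_def D_def)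
  then have "w - v = vec u d c D x - vec u d c D y" by (simp add: algebra_simps)
  then have eq: "w - v = ((snd x - snd y) / D) *\<^sub>R u + ((fst x - fst y) / D) *\<^sub>R d"
    by (simp add: vec_def algebra_simps diff_divide_distrib)
  have "cross u w - cross u v = cross u (w - v)" by (simp add: cross_simps)
  also have "\<dots> = fst x - fst y" using D unfolding eq by (simp add: cross_simps D_def)
  finally have 1: "fst x - fst y \<le> D" using beta[OF vw(2,1)] by (simp add: D_def)
  have "snd x - snd y \<le> D" if "fst x = fst y"
  proof -
    have "fst w - fst v = fst (w - v)" by simp
    also have "\<dots> = (snd x - snd y) / D * fst u" unfolding eq using that by simp
    finally have "(snd x - snd y) / D * fst u \<le> 1 * fst u" using width[OF vw(2,1)] by simp
    with u have "(snd x - snd y) / D \<le> 1" by (simp only: mult_le_cancel_right_pos)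
    with D show ?thesis by (simp add: D_def field_simps)
  qed
  with 1 show ?thesis by (simp add: D_def)
qed

section \<open>Counting separated points, and bounding the ply\<close>

lemma card_le_2_separated:
  fixes X :: "real set"
  assumes "finite X" "\<And>x y. x \<in> X \<Longrightarrow> y \<in> X \<Longrightarrow> x \<noteq> y \<Longrightarrow> e < \<bar>x - y\<bar> \<and> \<bar>x - y\<bar> \<le> 2 * e"
  shows "card X \<le> 2"
proof (rule ccontr)
  assume "\<not> card X \<le> 2"
  then obtain Y where Y: "Y \<subseteq> X" "card Y = 3"
    using obtain_subset_with_card_n[of 3 X] by auto
  then obtain x y z where "x \<in> X" "y \<in> X" "z \<in> X" "x \<noteq> y" "y \<noteq> z" "x \<noteq> z"
    by (auto simp: card_3_iff)
  \<comment> \<open>Among three reals with gaps above \<open>e\<close> the outer two are more than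
    \<open>2 * e\<close> apart.\<close>
  with assms(2)[of x y] assms(2)[of y z] assms(2)[of x z] show False by linarith
qed

text \<open>At most two distinct first coordinates occur, and each of these rows has at most two
  entries.\<close>

lemma card_le_4_separated:
  fixes Q :: "(real \<times> real) set"
  assumes fin: "finite Q"
    and fst: "\<And>x y. x \<in> Q \<Longrightarrow> y \<in> Q \<Longrightarrow> fst x \<noteq> fst y \<Longrightarrow> e < \<bar>fst x - fst y\<bar> \<and> \<bar>fst x - fst y\<bar> \<le> 2 * e"
    and snd: "\<And>x y. x \<in> Q \<Longrightarrow> y \<in> Q \<Longrightarrow> fst x = fst y \<Longrightarrow> x \<noteq> y \<Longrightarrow>
      e < \<bar>snd x - snd y\<bar> \<and> \<bar>snd x - snd y\<bar> \<le> 2 * e"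
  shows "card Q \<le> 4"
proof -
  have 1: "card (fst ` Q) \<le> 2"
    using fin fst by (intro card_le_2_separated[of _ e]) auto
  have fin2: "finite {y. (b, y) \<in> Q}" for b
    by (rule finite_subset[of _ "snd ` Q"]) (use fin in \<open>force+\<close>)
  have 2: "card {y. (b, y) \<in> Q} \<le> 2" for b
    by (rule card_le_2_separated[where e = e, OF fin2]) (use snd[of "(b, _)" "(b, _)"] in auto)
  have "Q = (SIGMA b : fst ` Q. {y. (b, y) \<in> Q})" by force
  then have "card Q = card (SIGMA b : fst ` Q. {y. (b, y) \<in> Q})" by simp
  also have "\<dots> = (\<Sum>b \<in> fst ` Q. card {y. (b, y) \<in> Q})"
    using fin fin2 by (intro card_SigmaI) auto
  also have "\<dots> \<le> card (fst ` Q) * 2"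
    using sum_bounded_above[of "fst ` Q" "\<lambda>b. card {y. (b, y) \<in> Q}" 2] 2 by simp
  finally show ?thesis using 1 by simp
qed

text \<open>The common bound also makes the set of counts finite, so that \<open>Max\<close> is a
  genuine maximum.\<close>

lemma ply_le:
  assumes "\<And>p. card {s \<in> S. p \<in> s} \<le> k"
  shows "ply S \<le> k"
proof -
  have "{card {s \<in> S. p \<in> s} | p. True} \<subseteq> {..k}" using assms by auto
  then have "finite {card {s \<in> S. p \<in> s} | p. True}" by (rule finite_subset) simp
  then show ?thesis unfolding ply_def using assms by (subst Max_le_iff) auto
qed

section \<open>Reasoning about programs with a time budget\<close>

text \<open>The postcondition receives the unused part of the budget; this makes the rule for
  sequential composition an equation.\<close>

definition wp :: "com \<Rightarrow> state \<Rightarrow> nat \<Rightarrow> (state \<Rightarrow> nat \<Rightarrow> bool) \<Rightarrow> bool" where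
  "wp c s T Q \<longleftrightarrow> (\<exists>t s'. exec c s t s' \<and> t \<le> T \<and> Q s' (T - t))"

definition runs :: "com \<Rightarrow> state \<Rightarrow> nat \<Rightarrow> (state \<Rightarrow> bool) \<Rightarrow> bool" where
  "runs c s T Q \<longleftrightarrow> wp c s T (\<lambda>s' _. Q s')"

text \<open>Blocks simplification of the postcondition before the state is known.\<close>

lemma wp_weak_cong [cong]:
  "c = c' \<Longrightarrow> s = s' \<Longrightarrow> T = T' \<Longrightarrow> wp c s T Q = wp c' s' T' Q"
  by simp

section \<open>Budgeted execution of the single commands\<close>

lemma exec_Skip_iff: "exec Skip s t s' \<longleftrightarrow> t = 1 \<and> s' = s"
  by (subst exec.simps) auto

lemma exec_NWrite_iff: "exec (NWrite a i e) s t s' \<longleftrightarrow>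
    t = 1 + ncost i + ncost e \<and> s' = nwrite a (nval i s) (nval e s) s"
  by (subst exec.simps) auto

lemma exec_RWrite_iff: "exec (RWrite a i e) s t s' \<longleftrightarrow>
    t = 1 + ncost i + rcost e \<and> s' = rwrite a (nval i s) (rval e s) s"
  by (subst exec.simps) auto

lemma exec_Seq_iff: "exec (Seq c d) s t s' \<longleftrightarrow>
    (\<exists>t1 s1 t2. exec c s t1 s1 \<and> exec d s1 t2 s' \<and> t = t1 + t2)"
  by (subst exec.simps) auto

lemma exec_Cond_iff: "exec (Cond b c d) s t s' \<longleftrightarrow>
    (\<exists>u. exec (if bval b s then c else d) s u s' \<and> t = 1 + bcost b + u)"
  by (subst exec.simps) auto

lemma wp_Skip: "wp Skip s T Q \<longleftrightarrow> 1 \<le> T \<and> Q s (T - 1)"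
  unfolding wp_def exec_Skip_iff by auto

lemma wp_NWrite: "wp (NWrite a i e) s T Q \<longleftrightarrow>
    1 + ncost i + ncost e \<le> T \<and> Q (nwrite a (nval i s) (nval e s) s) (T - (1 + ncost i + ncost e))"
  unfolding wp_def exec_NWrite_iff by auto

lemma wp_RWrite: "wp (RWrite a i e) s T Q \<longleftrightarrow>
    1 + ncost i + rcost e \<le> T \<and> Q (rwrite a (nval i s) (rval e s) s) (T - (1 + ncost i + rcost e))"
  unfolding wp_def exec_RWrite_iff by auto

lemma wp_Seq: "wp (Seq c d) s T Q \<longleftrightarrow> wp c s T (\<lambda>s' T'. wp d s' T' Q)"
proof
  assume "wp (Seq c d) s T Q"
  then obtain t s' where "exec (Seq c d) s t s'" "t \<le> T" "Q s' (T - t)"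
    unfolding wp_def by blast
  moreover from this(1) obtain t1 t2 s1 where
    "exec c s t1 s1" "exec d s1 t2 s'" "t = t1 + t2" by (auto simp: exec_Seq_iff)
  ultimately show "wp c s T (\<lambda>s' T'. wp d s' T' Q)"
    unfolding wp_def
    by (intro exI[of _ t1] exI[of _ s1] conjI exI[of _ t2] exI[of _ s']) auto
next
  assume "wp c s T (\<lambda>s' T'. wp d s' T' Q)"
  then obtain t1 s1 t2 s2 where "exec c s t1 s1" "t1 \<le> T" "exec d s1 t2 s2" "t2 \<le> T - t1"
    "Q s2 (T - t1 - t2)"
    unfolding wp_def by blast
  then show "wp (Seq c d) s T Q"
    unfolding wp_def by (intro exI[of _ "t1 + t2"] exI[of _ s2]) (auto intro: exec.Seq)
qed

lemma wp_Cond: "wp (Cond b c d) s T Q \<longleftrightarrow>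
    1 + bcost b \<le> T \<and> wp (if bval b s then c else d) s (T - (1 + bcost b)) Q"
proof -
  have "wp (Cond b c d) s T Q \<longleftrightarrow> (\<exists>u s'. exec (if bval b s then c else d) s u s' \<and>
      1 + bcost b + u \<le> T \<and> Q s' (T - (1 + bcost b + u)))"
    unfolding wp_def exec_Cond_iff by blast
  also have "\<dots> \<longleftrightarrow> (\<exists>u s'. exec (if bval b s then c else d) s u s' \<and> 1 + bcost b \<le> T \<and>
      u \<le> T - (1 + bcost b) \<and> Q s' (T - (1 + bcost b) - u))"
  proof -
    have "1 + bcost b + u \<le> T \<longleftrightarrow> 1 + bcost b \<le> T \<and> u \<le> T - (1 + bcost b)"
      "T - (1 + bcost b + u) = T - (1 + bcost b) - u" for u
      by linarith+
    then show ?thesis by metis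
  qed
  finally show ?thesis
    unfolding wp_def by blast
qed

text \<open>Straight-line code is executed symbolically by rewriting with these equations; loops go
  through \<open>runs_While\<close>.\<close>

lemmas wp_simps = wp_Skip wp_NWrite wp_RWrite wp_Seq wp_Cond

lemma runs_iff: "runs c s T Q \<longleftrightarrow> (\<exists>t s'. exec c s t s' \<and> t \<le> T \<and> Q s')"
  unfolding runs_def wp_def by blast

lemma runs_mono: "runs c s T Q \<Longrightarrow> T \<le> T' \<Longrightarrow> (\<And>s'. Q s' \<Longrightarrow> Q' s') \<Longrightarrow> runs c s T' Q'"
  unfolding runs_iff by (meson le_trans)

lemma runs_Seq:
  assumes "runs c s T1 R" "\<And>s'. R s' \<Longrightarrow> runs d s' T2 Q" "T1 + T2 \<le> T"
  shows "runs (Seq c d) s T Q"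
proof -
  from assms(1) obtain t s' where 1: "exec c s t s'" "t \<le> T1" "R s'"
    unfolding runs_iff by blast
  from assms(2)[OF 1(3)] obtain u s'' where 2: "exec d s' u s''" "u \<le> T2" "Q s''"
    unfolding runs_iff by blast
  show ?thesis
    unfolding runs_iff using 1 2 assms(3)
    by (intro exI[of _ "t + u"] exI[of _ s'']) (auto intro: exec.Seq)
qed

section \<open>Frame conditions\<close>

primrec nwrites :: "com \<Rightarrow> string set" where
  "nwrites Skip = {}"
| "nwrites (NWrite a i e) = {a}"
| "nwrites (RWrite a i e) = {}"
| "nwrites (Seq c d) = nwrites c \<union> nwrites d"
| "nwrites (Cond b c d) = nwrites c \<union> nwrites d"
| "nwrites (While b c) = nwrites c"

primrec rwrites :: "com \<Rightarrow> string set" where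
  "rwrites Skip = {}"
| "rwrites (NWrite a i e) = {}"
| "rwrites (RWrite a i e) = {a}"
| "rwrites (Seq c d) = rwrites c \<union> rwrites d"
| "rwrites (Cond b c d) = rwrites c \<union> rwrites d"
| "rwrites (While b c) = rwrites c"

text \<open>The frame condition read off from the program text. It holds for every run by
  \<open>exec_unchanged\<close>, so specifications need only mention what changes.\<close>

definition unchanged :: "com \<Rightarrow> state \<Rightarrow> state \<Rightarrow> bool" where
  "unchanged c s s' \<longleftrightarrow> (\<forall>a. a \<notin> nwrites c \<longrightarrow> nmem s' a = nmem s a) \<and>
     (\<forall>a. a \<notin> rwrites c \<longrightarrow> rmem s' a = rmem s a)"

lemma unchanged_n: "unchanged c s s' \<Longrightarrow> a \<notin> nwrites c \<Longrightarrow> nmem s' a = nmem s a"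
  and unchanged_r: "unchanged c s s' \<Longrightarrow> a \<notin> rwrites c \<Longrightarrow> rmem s' a = rmem s a"
  unfolding unchanged_def by auto

lemma nmem_nwrite [simp]: "nmem (nwrite a i k s) = (nmem s)(a := (nmem s a)(i := k))"
  and rmem_nwrite [simp]: "rmem (nwrite a i k s) = rmem s"
  and rmem_rwrite [simp]: "rmem (rwrite a i x s) = (rmem s)(a := (rmem s a)(i := x))"
  and nmem_rwrite [simp]: "nmem (rwrite a i x s) = nmem s"
  by (auto simp: nwrite_def rwrite_def)

lemma exec_unchanged: "exec c s t s' \<Longrightarrow> unchanged c s s'"
  by (induction rule: exec.induct) (auto simp: unchanged_def)

lemma runs_unchanged: "runs c s T Q \<Longrightarrow> runs c s T (\<lambda>s'. Q s' \<and> unchanged c s s')"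
  unfolding runs_iff by (meson exec_unchanged)

text \<open>The measure \<open>f\<close> bounds the number of iterations, and the extra 1 in the
  budget pays for the final failing test. Offering \<open>unchanged\<close> relative to the initial
  state in the premises keeps frame facts out of the invariants.\<close>

lemma runs_While:
  assumes I: "I s"
    and step: "\<And>s'. I s' \<Longrightarrow> unchanged c s s' \<Longrightarrow> bval b s' \<Longrightarrow>
      runs c s' K (\<lambda>s''. I s'' \<and> f s'' < f s')"
    and post: "\<And>s'. I s' \<Longrightarrow> unchanged c s s' \<Longrightarrow> \<not> bval b s' \<Longrightarrow> Q s'"
    and T: "(f s + 1) * (K + 1 + bcost b) \<le> T"
  shows "runs (While b c) s T Q"
proof -
  have "\<exists>t s''. exec (While b c) s' t s'' \<and> t \<le> f s' * (K + 1 + bcost b) + (1 + bcost b) \<and> Q s''"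
    if "I s'" "unchanged c s s'" for s'
    using that
  proof (induction "f s'" arbitrary: s' rule: less_induct)
    case (less s')
    show ?case
    proof (cases "bval b s'")
      case False
      with less.prems post exec.WhileFalse[OF False, of c] show ?thesis by (meson le_add2)
    next
      case True
      from step[OF less.prems True] obtain t s1 where
        1: "exec c s' t s1" "t \<le> K" "I s1" "f s1 < f s'"
        unfolding runs_iff by blast
      have "unchanged c s s1"
        using exec_unchanged[OF 1(1)] less.prems(2) unfolding unchanged_def by simp
      from less.hyps[OF 1(4) 1(3) this] obtain u s2 where
        2: "exec (While b c) s1 u s2" "u \<le> f s1 * (K + 1 + bcost b) + (1 + bcost b)" "Q s2"
        by blast
      have "(f s1 + 1) * (K + 1 + bcost b) \<le> f s' * (K + 1 + bcost b)"
        using 1(4) by (intro mult_right_mono) auto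
      with 1(2) 2(2) have "1 + bcost b + t + u \<le> f s' * (K + 1 + bcost b) + (1 + bcost b)"
        by (simp add: algebra_simps)
      with exec.WhileTrue[OF True 1(1) 2(1)] 2(3) show ?thesis by blast
    qed
  qed
  from this[of s] I obtain t s'' where "exec (While b c) s t s''"
    "t \<le> f s * (K + 1 + bcost b) + (1 + bcost b)" "Q s''"
    by (auto simp: unchanged_def)
  with T show ?thesis
    unfolding runs_iff by (intro exI[of _ t] exI[of _ s'']) (auto simp: algebra_simps)
qed

abbreviation nvar :: "string \<Rightarrow> nexp" where "nvar a \<equiv> NRead a (NConst 0)"
abbreviation rvar :: "string \<Rightarrow> rexp" where "rvar a \<equiv> RRead a (NConst 0)"
abbreviation nset :: "string \<Rightarrow> nexp \<Rightarrow> com" where "nset a \<equiv> NWrite a (NConst 0)"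
abbreviation rset :: "string \<Rightarrow> rexp \<Rightarrow> com" where "rset a \<equiv> RWrite a (NConst 0)"
abbreviation incr :: "string \<Rightarrow> com" where "incr a \<equiv> nset a (NAdd (nvar a) (NConst 1))"
abbreviation seq_op :: "com \<Rightarrow> com \<Rightarrow> com" (infixr ";;" 60) where "c ;; d \<equiv> Seq c d"

section \<open>Merge sort\<close>

definition lex_le :: "real \<times> real \<Rightarrow> real \<times> real \<Rightarrow> bool" where
  "lex_le x y \<longleftrightarrow> fst x < fst y \<or> fst x = fst y \<and> snd x \<le> snd y"

lemma lex_le_refl [simp]: "lex_le x x"
  and lex_le_trans: "lex_le x y \<Longrightarrow> lex_le y z \<Longrightarrow> lex_le x z"
  by (auto simp: lex_le_def)

text \<open>Invariant of bottom-up merge sort: blocks are aligned at multiples of \<open>w\<close>,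
  and \<open>n\<close> may cut the last one short. Width 1 is trivial, and width at least
  \<open>n\<close> means fully sorted.\<close>

definition block_sorted :: "nat \<Rightarrow> (nat \<Rightarrow> real \<times> real) \<Rightarrow> nat \<Rightarrow> bool" where
  "block_sorted w f n \<longleftrightarrow>
     (\<forall>c p q. c * w \<le> p \<longrightarrow> p \<le> q \<longrightarrow> q < c * w + w \<longrightarrow> q < n \<longrightarrow> lex_le (f p) (f q))"

lemma block_sortedD:
  "block_sorted w f n \<Longrightarrow> c * w \<le> p \<Longrightarrow> p \<le> q \<Longrightarrow> q < c * w + w \<Longrightarrow> q < n \<Longrightarrow> lex_le (f p) (f q)"
  unfolding block_sorted_def by blast

text \<open>The runs \<open>f ` {i..<e}\<close> and \<open>f ` {j..<h}\<close> of the current block, which starts at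
  \<open>c * (2 * w)\<close>, are still to be merged; \<open>out\<close> entries of \<open>g\<close> are final.\<close>

definition merging ::
  "nat \<Rightarrow> nat \<Rightarrow> (nat \<Rightarrow> real \<times> real) \<Rightarrow> nat \<Rightarrow> nat \<Rightarrow> nat \<Rightarrow> nat \<Rightarrow> nat \<Rightarrow> (nat \<Rightarrow> real \<times> real) \<Rightarrow> bool"
where
  "merging w n f i e j h out g \<longleftrightarrow> block_sorted w f n \<and> 0 < w \<and>
     i \<le> e \<and> e \<le> j \<and> j \<le> h \<and> out + e = i + j \<and>
     g ` {..<out} \<union> f ` {i..<e} \<union> f ` {j..<n} = f ` {..<n} \<and>
     block_sorted (2 * w) g out \<and>
     (\<exists>c. c * (2 * w) \<le> i \<and> e = min (c * (2 * w) + w) n \<and> h = min (e + w) n \<and>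
       (\<forall>p x. c * (2 * w) \<le> p \<longrightarrow> p < out \<longrightarrow> x \<in> {i..<e} \<union> {j..<h} \<longrightarrow> lex_le (g p) (f x)))"

lemma merging_init:
  assumes "block_sorted w f n" "0 < w"
  shows "merging w n f 0 (min w n) (min w n) (min (min w n + w) n) 0 g"
proof -
  have "{0..<min w n} \<union> {min w n..<n} = {..<n}" by auto
  then have "f ` {0..<min w n} \<union> f ` {min w n..<n} = f ` {..<n}"
    by (simp flip: image_Un)
  with assms show ?thesis
    unfolding merging_def by (auto simp: block_sorted_def intro!: exI[of _ 0])
qed

lemma merging_next:
  assumes "merging w n f i e j h out g" "\<not> out < h" "out < n"
  shows "merging w n f h (min (h + w) n) (min (h + w) n) (min (min (h + w) n + w) n) out g \<and>
    out < min (min (h + w) n + w) n"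
proof -
  from assms(1) obtain c where m: "block_sorted w f n" "0 < w"
     "i \<le> e" "e \<le> j" "j \<le> h" "out + e = i + j"
     "g ` {..<out} \<union> f ` {i..<e} \<union> f ` {j..<n} = f ` {..<n}"
     "block_sorted (2 * w) g out"
     "c * (2 * w) \<le> i" "e = min (c * (2 * w) + w) n" "h = min (e + w) n"
    unfolding merging_def by blast
  \<comment> \<open>\<open>out + e = i + j\<close> with \<open>i \<le> e\<close>,
    \<open>j \<le> h\<close> and \<open>h \<le> out\<close> leaves only equalities.\<close>
  have eq: "i = e" "j = h" "out = h" using m assms(2) by linarith+
  \<comment> \<open>Since \<open>h < n\<close>, neither minimum was cut off at \<open>n\<close>, so
    the next block starts aligned.\<close>
  have "h = c * (2 * w) + 2 * w" using m(2,10,11) eq assms(3) by (simp add: min_def split: if_splits)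
  then have h: "h = (c + 1) * (2 * w)" by simp
  have u: "{h..<min (h + w) n} \<union> {min (h + w) n..<n} = {h..<n}" using eq assms(3) by auto
  have "g ` {..<out} \<union> (f ` {h..<min (h + w) n} \<union> f ` {min (h + w) n..<n}) = f ` {..<n}"
    unfolding image_Un[symmetric] u using m(7) eq by simp
  then have img: "g ` {..<out} \<union> f ` {h..<min (h + w) n} \<union> f ` {min (h + w) n..<n} = f ` {..<n}"
    by (simp only: Un_assoc)
  have b: "(c + 1) * (2 * w) = h" using h by simp
  have "h < n" using eq assms(3) by simp
  show ?thesis
    unfolding merging_def
    using m(1,2,8) img eq(3) \<open>h < n\<close> by (intro conjI exI[of _ "c + 1"]; (unfold b)?) simp_all
qed

text \<open>Only the block starting at \<open>b\<close> gains an entry that has predecessors to be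
  compared with.\<close>

lemma block_sorted_extend:
  assumes "block_sorted w g out" "b = c * w" "b \<le> out" "out < b + w"
    and "\<And>p. b \<le> p \<Longrightarrow> p < out \<Longrightarrow> lex_le (g p) y"
  shows "block_sorted w (g(out := y)) (Suc out)"
  unfolding block_sorted_def
proof (intro allI impI)
  fix c' p q assume a: "c' * w \<le> p" "p \<le> q" "q < c' * w + w" "q < Suc out"
  show "lex_le ((g(out := y)) p) ((g(out := y)) q)"
  proof (cases "q = out")
    case False
    with a show ?thesis using block_sortedD[OF assms(1)] by auto
  next
    case True
    \<comment> \<open>An earlier block ends at or before \<open>b \<le> out\<close> and so cannot
      contain position \<open>out\<close>.\<close>
    have "\<not> c' < c"
    proof
      assume "c' < c"
      then have "Suc c' * w \<le> c * w" by (intro mult_right_mono) auto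
      with a assms True show False by simp
    qed
    then have "c * w \<le> c' * w" by (intro mult_right_mono) auto
    with a(1) have "b \<le> p" using assms(2) by linarith
    with a(2) True assms(5)[of p] show ?thesis by auto
  qed
qed

text \<open>\<open>f i\<close> is at most every pending entry of the current block, so it may be
  output next; the condition on \<open>f j\<close> is vacuous once the right run is
  exhausted.\<close>

lemma merging_left:
  assumes "merging w n f i e j h out g" "i < e" "j < h \<Longrightarrow> lex_le (f i) (f j)"
  shows "merging w n f (Suc i) e j h (Suc out) (g(out := f i))"
proof -
  from assms(1) obtain c where m: "block_sorted w f n" "0 < w"
     "i \<le> e" "e \<le> j" "j \<le> h" "out + e = i + j"
     "g ` {..<out} \<union> f ` {i..<e} \<union> f ` {j..<n} = f ` {..<n}"
     "block_sorted (2 * w) g out"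
     "c * (2 * w) \<le> i" "e = min (c * (2 * w) + w) n" "h = min (e + w) n"
     "\<And>p x. c * (2 * w) \<le> p \<Longrightarrow> p < out \<Longrightarrow> x \<in> {i..<e} \<union> {j..<h} \<Longrightarrow> lex_le (g p) (f x)"
    unfolding merging_def by blast
  \<comment> \<open>In terms of blocks of width \<open>w\<close>, the left run belongs to block
    \<open>2 * c\<close> and the right run to block \<open>2 * c + 1\<close>.\<close>
  have l: "lex_le (f i) (f x)" if "x \<in> {i..<e}" for x
    using that m by (intro block_sortedD[OF m(1), where c = "2 * c"]) auto
  have r: "lex_le (f i) (f x)" if "x \<in> {j..<h}" for x
    using that m assms(2) by (intro lex_le_trans[OF assms(3)] block_sortedD[OF m(1), where c = "2 * c + 1"]) auto
  have "(g(out := f i)) ` {..<Suc out} = insert (f i) (g ` {..<out})"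
    by (auto simp: lessThan_Suc)
  moreover have "{i..<e} = insert i {Suc i..<e}" using assms(2) by auto
  then have "f ` {i..<e} = insert (f i) (f ` {Suc i..<e})" by simp
  ultimately have "(g(out := f i)) ` {..<Suc out} \<union> f ` {Suc i..<e} \<union> f ` {j..<n} = f ` {..<n}"
    using m(7) by auto
  moreover have "block_sorted (2 * w) (g(out := f i)) (Suc out)"
    using m assms(2) by (intro block_sorted_extend[OF m(8) refl]) auto
  ultimately show ?thesis
    unfolding merging_def using m assms(2) l r by (auto intro!: exI[of _ c] simp: less_Suc_eq)
qed

lemma merging_right:
  assumes "merging w n f i e j h out g" "j < h" "i < e \<Longrightarrow> lex_le (f j) (f i)"
  shows "merging w n f i e (Suc j) h (Suc out) (g(out := f j))"
proof -
  from assms(1) obtain c where m: "block_sorted w f n" "0 < w"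
     "i \<le> e" "e \<le> j" "j \<le> h" "out + e = i + j"
     "g ` {..<out} \<union> f ` {i..<e} \<union> f ` {j..<n} = f ` {..<n}"
     "block_sorted (2 * w) g out"
     "c * (2 * w) \<le> i" "e = min (c * (2 * w) + w) n" "h = min (e + w) n"
     "\<And>p x. c * (2 * w) \<le> p \<Longrightarrow> p < out \<Longrightarrow> x \<in> {i..<e} \<union> {j..<h} \<Longrightarrow> lex_le (g p) (f x)"
    unfolding merging_def by blast
  have r: "lex_le (f j) (f x)" if "x \<in> {j..<h}" for x
    using that m assms(2) by (intro block_sortedD[OF m(1), where c = "2 * c + 1"]) auto
  have l: "lex_le (f j) (f x)" if "x \<in> {i..<e}" for x
    using that m assms(2) by (intro lex_le_trans[OF assms(3)] block_sortedD[OF m(1), where c = "2 * c"]) auto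
  have "(g(out := f j)) ` {..<Suc out} = insert (f j) (g ` {..<out})"
    by (auto simp: lessThan_Suc)
  moreover have "{j..<n} = insert j {Suc j..<n}" using m assms(2) by auto
  then have "f ` {j..<n} = insert (f j) (f ` {Suc j..<n})" by simp
  ultimately have "(g(out := f j)) ` {..<Suc out} \<union> f ` {i..<e} \<union> f ` {Suc j..<n} = f ` {..<n}"
    using m(7) by auto
  moreover have "block_sorted (2 * w) (g(out := f j)) (Suc out)"
    using m assms(2) by (intro block_sorted_extend[OF m(8) refl]) auto
  ultimately show ?thesis
    unfolding merging_def using m assms(2) l r by (auto intro!: exI[of _ c] simp: less_Suc_eq)
qed

lemma merging_done:
  assumes "merging w n f i e j h out g" "\<not> out < n"
  shows "block_sorted (2 * w) g n \<and> g ` {..<n} = f ` {..<n}"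
proof -
  from assms(1) have "i \<le> e" "j \<le> h" "h \<le> n" "out + e = i + j"
    unfolding merging_def by auto
  with assms(2) have "i = e" "j = n" "out = n" by linarith+
  with assms(1) show ?thesis unfolding merging_def by simp
qed

text \<open>With truncated subtraction \<open>x - (x - y)\<close> is the minimum, for which the
  machine has no operation.\<close>

definition nmin :: "nexp \<Rightarrow> nexp \<Rightarrow> nexp" where
  "nmin x y = NSub x (NSub x y)"

lemma nval_nmin [simp]: "nval (nmin x y) s = min (nval x s) (nval y s)"
  and ncost_nmin [simp]: "ncost (nmin x y) = 2 + 2 * ncost x + ncost y"
  by (auto simp: nmin_def)

text \<open>Started with \<open>h = 0\<close>, the same code also sets up the first block, as in
  \<open>merging_init\<close>.\<close>

definition next_block :: com where
  "next_block =
     nset ''i'' (nvar ''h'') ;;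
     nset ''e'' (nmin (NAdd (nvar ''h'') (nvar ''w'')) (nvar ''n'')) ;;
     nset ''j'' (nvar ''e'') ;;
     nset ''h'' (nmin (NAdd (nvar ''e'') (nvar ''w'')) (nvar ''n''))"

text \<open>Strict lexicographic comparison; the disjunction is written by De Morgan with
  \<open>BNot\<close> and \<open>BAnd\<close>.\<close>

definition right_smaller :: bexp where
  "right_smaller = BNot (BAnd
     (BNot (RLess (RRead ''b'' (nvar ''j'')) (RRead ''b'' (nvar ''i''))))
     (BNot (BAnd (BNot (RLess (RRead ''b'' (nvar ''i'')) (RRead ''b'' (nvar ''j''))))
                 (RLess (RRead ''g'' (nvar ''j'')) (RRead ''g'' (nvar ''i''))))))"

definition emit :: "string \<Rightarrow> com" where
  "emit x =
     RWrite ''tb'' (nvar ''o'') (RRead ''b'' (nvar x)) ;;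
     RWrite ''tg'' (nvar ''o'') (RRead ''g'' (nvar x)) ;;
     incr ''o'' ;; incr x"

text \<open>The comparison may read beyond an exhausted run; then the index tests alone decide the
  outcome.\<close>

definition merge_step :: com where
  "merge_step =
     Cond (NLess (nvar ''o'') (nvar ''h'')) Skip next_block ;;
     Cond (BAnd (NLess (nvar ''j'') (nvar ''h''))
                (BNot (BAnd (NLess (nvar ''i'') (nvar ''e'')) (BNot right_smaller))))
       (emit ''j'') (emit ''i'')"

definition copy_step :: com where
  "copy_step =
     RWrite ''b'' (nvar ''i'') (RRead ''tb'' (nvar ''i'')) ;;
     RWrite ''g'' (nvar ''i'') (RRead ''tg'' (nvar ''i'')) ;;
     incr ''i''"

definition merge_pass :: com where
  "merge_pass =
     (nset ''h'' (NConst 0) ;; next_block ;; nset ''o'' (NConst 0)) ;;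
     While (NLess (nvar ''o'') (nvar ''n'')) merge_step ;;
     nset ''i'' (NConst 0) ;;
     While (NLess (nvar ''i'') (nvar ''n'')) copy_step ;;
     nset ''w'' (NAdd (nvar ''w'') (nvar ''w''))"

definition merge_sort :: com where
  "merge_sort = nset ''w'' (NConst 1) ;; While (NLess (nvar ''w'') (nvar ''n'')) merge_pass"

section \<open>Correctness and running time of the sorting program\<close>

definition pts :: "state \<Rightarrow> nat \<Rightarrow> real \<times> real" where
  "pts s k = (rmem s ''b'' k, rmem s ''g'' k)"

definition tmp :: "state \<Rightarrow> nat \<Rightarrow> real \<times> real" where
  "tmp s k = (rmem s ''tb'' k, rmem s ''tg'' k)"

definition merging_state :: "state \<Rightarrow> bool" where
  "merging_state s \<longleftrightarrow> merging (nmem s ''w'' 0) (nmem s ''n'' 0) (pts s) (nmem s ''i'' 0)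
     (nmem s ''e'' 0) (nmem s ''j'' 0) (nmem s ''h'' 0) (nmem s ''o'' 0) (tmp s)"

lemma pts_nwrite [simp]: "pts (nwrite a i k s) = pts s"
  and tmp_nwrite [simp]: "tmp (nwrite a i k s) = tmp s"
  by (auto simp: pts_def tmp_def)

lemma pts_rwrite [simp]:
  "a \<noteq> ''b'' \<Longrightarrow> a \<noteq> ''g'' \<Longrightarrow> pts (rwrite a i x s) = pts s"
  by (auto simp: pts_def)

lemma tmp_rwrite2: "tmp (rwrite ''tg'' i y (rwrite ''tb'' i x s)) = (tmp s)(i := (x, y))"
  by (auto simp: tmp_def)

lemma pts_rwrite2: "pts (rwrite ''g'' i y (rwrite ''b'' i x s)) = (pts s)(i := (x, y))"
  by (auto simp: pts_def)

lemma bval_right_smaller: "bval right_smaller s \<longleftrightarrow>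
    \<not> lex_le (pts s (nmem s ''i'' 0)) (pts s (nmem s ''j'' 0))"
  by (auto simp: right_smaller_def lex_le_def pts_def)

lemma advance_runs:
  assumes "merging_state s" "nmem s ''o'' 0 < nmem s ''n'' 0"
  shows "runs (Cond (NLess (nvar ''o'') (nvar ''h'')) Skip next_block) s 60
    (\<lambda>s'. merging_state s' \<and> nmem s' ''o'' 0 < nmem s' ''h'' 0)"
proof (cases "nmem s ''o'' 0 < nmem s ''h'' 0")
  case True
  with assms show ?thesis by (simp add: runs_def wp_simps)
next
  case False
  with merging_next[OF assms(1)[unfolded merging_state_def] False assms(2)] show ?thesis
    by (simp add: runs_def wp_simps next_block_def merging_state_def)
qed

lemma emit_runs:
  assumes "x = ''i'' \<or> x = ''j''"
  shows "runs (emit x) s 40 (\<lambda>s'. pts s' = pts s \<and>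
    tmp s' = (tmp s)(nmem s ''o'' 0 := pts s (nmem s x 0)) \<and>
    nmem s' x 0 = Suc (nmem s x 0) \<and> nmem s' ''o'' 0 = Suc (nmem s ''o'' 0) \<and>
    (\<forall>a. a \<noteq> x \<and> a \<noteq> ''o'' \<longrightarrow> nmem s' a = nmem s a))"
  using assms by (auto simp: runs_def wp_simps emit_def tmp_rwrite2 pts_def[of s])

lemma merge_step_runs:
  assumes "merging_state s" "nmem s ''o'' 0 < nmem s ''n'' 0"
  shows "runs merge_step s 160
    (\<lambda>s'. merging_state s' \<and> nmem s' ''o'' 0 = Suc (nmem s ''o'' 0))"
  unfolding merge_step_def
proof (rule runs_Seq[where ?T2.0 = 100, OF runs_unchanged[OF advance_runs[OF assms]]], goal_cases)
  case (1 s1)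
  then have o: "nmem s1 ''o'' = nmem s ''o''"
    by (simp add: unchanged_def next_block_def)
  have m: "merging (nmem s1 ''w'' 0) (nmem s1 ''n'' 0) (pts s1) (nmem s1 ''i'' 0)
     (nmem s1 ''e'' 0) (nmem s1 ''j'' 0) (nmem s1 ''h'' 0) (nmem s1 ''o'' 0) (tmp s1)"
    and lt: "nmem s1 ''o'' 0 < nmem s1 ''h'' 0"
    using 1 by (simp_all add: merging_state_def)
  \<comment> \<open>By \<open>out + e = i + j\<close>, two exhausted runs would give
    \<open>out = h\<close>.\<close>
  have ex: "nmem s1 ''i'' 0 < nmem s1 ''e'' 0 \<or> nmem s1 ''j'' 0 < nmem s1 ''h'' 0"
    using m lt unfolding merging_def by auto
  have cost: "bcost right_smaller = 27"
    by (simp add: right_smaller_def)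
  let ?b = "BAnd (NLess (nvar ''j'') (nvar ''h''))
    (BNot (BAnd (NLess (nvar ''i'') (nvar ''e'')) (BNot right_smaller)))"
  let ?Q = "\<lambda>s'. merging_state s' \<and> nmem s' ''o'' 0 = Suc (nmem s1 ''o'' 0)"
  have i: "runs (emit ''i'') s1 40 ?Q" if b: "\<not> bval ?b s1"
  proof (rule runs_mono[OF emit_runs order_refl], goal_cases)
    case (2 s2)
    have "nmem s1 ''i'' 0 < nmem s1 ''e'' 0" using b ex by auto
    from merging_left[OF m this] b 2 show ?case
      by (auto simp: merging_state_def bval_right_smaller)
  qed simp
  have j: "runs (emit ''j'') s1 40 ?Q" if b: "bval ?b s1"
  proof (rule runs_mono[OF emit_runs order_refl], goal_cases)
    case (2 s2)
    have "lex_le (pts s1 (nmem s1 ''j'' 0)) (pts s1 (nmem s1 ''i'' 0))"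
      if "nmem s1 ''i'' 0 < nmem s1 ''e'' 0"
      using b that by (auto simp: bval_right_smaller lex_le_def)
    with merging_right[OF m] b 2 show ?case
      by (auto simp: merging_state_def)
  qed simp
  have "runs (if bval ?b s1 then emit ''j'' else emit ''i'') s1 40 ?Q"
    using i j by simp
  then have "runs (Cond ?b (emit ''j'') (emit ''i'')) s1 100 ?Q"
    unfolding runs_iff exec_Cond_iff by (fastforce simp: cost)
  with o show ?case by simp
qed simp

lemma copy_loop_runs:
  assumes "nmem s ''i'' 0 = 0"
  shows "runs (While (NLess (nvar ''i'') (nvar ''n'')) copy_step) s (30 * (nmem s ''n'' 0 + 1))
    (\<lambda>s'. \<forall>k < nmem s ''n'' 0. pts s' k = tmp s k)"
proof (rule runs_While[where f = "\<lambda>s'. nmem s' ''n'' 0 - nmem s' ''i'' 0" and K = 20 and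
      I = "\<lambda>s'. nmem s' ''i'' 0 \<le> nmem s ''n'' 0 \<and> (\<forall>k < nmem s' ''i'' 0. pts s' k = tmp s k)"], goal_cases)
  case (2 s')
  then have "nmem s' ''n'' = nmem s ''n''" "tmp s' = tmp s"
    by (auto simp: unchanged_def copy_step_def tmp_def fun_eq_iff)
  with 2 show ?case
    by (auto simp: runs_def wp_simps copy_step_def pts_rwrite2 less_Suc_eq) (auto simp: tmp_def fun_eq_iff)
next
  case (3 s')
  then have "nmem s' ''n'' = nmem s ''n''"
    by (auto simp: unchanged_def copy_step_def)
  with 3 show ?case by auto
qed (use assms in auto)

lemma block_sorted_cong:
  "(\<And>k. k < n \<Longrightarrow> f k = g k) \<Longrightarrow> block_sorted w f n = block_sorted w g n"
  by (auto simp: block_sorted_def)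

lemma merge_pass_runs:
  assumes "block_sorted (nmem s ''w'' 0) (pts s) (nmem s ''n'' 0)" "0 < nmem s ''w'' 0"
  shows "runs merge_pass s (300 * (nmem s ''n'' 0 + 1))
    (\<lambda>s'. nmem s' ''w'' 0 = 2 * nmem s ''w'' 0 \<and>
       block_sorted (nmem s' ''w'' 0) (pts s') (nmem s ''n'' 0) \<and>
       pts s' ` {..<nmem s ''n'' 0} = pts s ` {..<nmem s ''n'' 0})"
proof -
  define n where "n = nmem s ''n'' 0"
  define w where "w = nmem s ''w'' 0"
  have init: "runs (nset ''h'' (NConst 0) ;; next_block ;; nset ''o'' (NConst 0)) s 50
      (\<lambda>s'. merging_state s' \<and> nmem s' ''n'' 0 = n \<and> nmem s' ''w'' 0 = w \<and> pts s' = pts s \<and> nmem s' ''o'' 0 = 0)"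
    using merging_init[OF assms]
    by (simp add: runs_def wp_simps next_block_def merging_state_def n_def w_def)
  have loop: "runs (While (NLess (nvar ''o'') (nvar ''n'')) merge_step) s1 (170 * (n + 1))
      (\<lambda>s'. block_sorted (2 * w) (tmp s') n \<and> tmp s' ` {..<n} = pts s ` {..<n} \<and>
         nmem s' ''n'' 0 = n \<and> nmem s' ''w'' 0 = w)"
    if s1: "merging_state s1 \<and> nmem s1 ''n'' 0 = n \<and> nmem s1 ''w'' 0 = w \<and> pts s1 = pts s \<and> nmem s1 ''o'' 0 = 0" for s1
  proof (rule runs_While[where f = "\<lambda>s'. n - nmem s' ''o'' 0" and K = 160 and I = merging_state], goal_cases)
    case (2 s')
    then have "nmem s' ''n'' = nmem s1 ''n''"
      by (auto simp: unchanged_def merge_step_def next_block_def emit_def)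
    with 2 s1 show ?case
      by (intro runs_mono[OF merge_step_runs]) auto
  next
    case (3 s')
    then have "nmem s' ''n'' = nmem s1 ''n''" "nmem s' ''w'' = nmem s1 ''w''" "pts s' = pts s1"
      by (auto simp: unchanged_def merge_step_def next_block_def emit_def pts_def fun_eq_iff)
    with 3 s1 merging_done[of w n "pts s'" "nmem s' ''i'' 0" "nmem s' ''e'' 0" "nmem s' ''j'' 0"
        "nmem s' ''h'' 0" "nmem s' ''o'' 0" "tmp s'"]
    show ?case by (auto simp: merging_state_def)
  qed (use s1 in auto)
  have copy: "runs (nset ''i'' (NConst 0) ;;
        While (NLess (nvar ''i'') (nvar ''n'')) copy_step ;;
        nset ''w'' (NAdd (nvar ''w'') (nvar ''w''))) s2 (40 * (n + 1) + 10)
      (\<lambda>s'. nmem s' ''w'' 0 = 2 * w \<and> block_sorted (2 * w) (pts s') n \<and> pts s' ` {..<n} = pts s ` {..<n})"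
    if s2: "block_sorted (2 * w) (tmp s2) n \<and> tmp s2 ` {..<n} = pts s ` {..<n} \<and>
         nmem s2 ''n'' 0 = n \<and> nmem s2 ''w'' 0 = w" for s2
  proof (rule runs_Seq[where R = "\<lambda>s3. nmem s3 ''i'' 0 = 0 \<and> tmp s3 = tmp s2 \<and>
        nmem s3 ''n'' 0 = n \<and> nmem s3 ''w'' 0 = w" and ?T1.0 = 10 and ?T2.0 = "40 * (n + 1)"], goal_cases)
    case 1
    then show ?case using s2 by (simp add: runs_def wp_simps)
  next
    case (2 s3)
    then have "nmem s3 ''i'' 0 = 0" by simp
    from runs_unchanged[OF copy_loop_runs[OF this]] show ?case
    proof (rule runs_Seq[where ?T2.0 = 10], goal_cases)
      case (1 s4)
      have w: "nmem s4 ''w'' 0 = w" using 1 2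
        by (auto simp: unchanged_def copy_step_def)
      have eq: "\<And>k. k < n \<Longrightarrow> pts s4 k = tmp s2 k" using 1 2 by auto
      have "pts s4 ` {..<n} = tmp s2 ` {..<n}" using eq by (intro image_cong) auto
      with w s2 block_sorted_cong[of n "pts s4" "tmp s2" "2 * w"] eq show ?case
        by (simp add: runs_def wp_simps)
    qed (use 2 in simp)
  qed simp
  show ?thesis
    unfolding merge_pass_def
    by (rule runs_mono[OF runs_Seq[OF init runs_Seq[OF loop copy order_refl] order_refl]])
      (auto simp: n_def w_def)
qed

lemma block_sorted_1: "block_sorted (Suc 0) f n"
  unfolding block_sorted_def
proof (intro allI impI)
  fix c p q assume "c * Suc 0 \<le> p" "p \<le> q" "q < c * Suc 0 + Suc 0"
  then have "p = q" by simp
  then show "lex_le (f p) (f q)" by simp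
qed

text \<open>\<open>w\<close> stays a power of two, and a pass starts only if
  \<open>w < n \<le> 2 ^ R\<close>, so there are at most \<open>R\<close> passes of linear cost;
  afterwards block 0 contains everything. Preserving the set of entries is enough, as only coverage
  of the points is claimed.\<close>

lemma merge_sort_runs:
  assumes R: "nmem s ''n'' 0 \<le> 2 ^ R"
  shows "runs merge_sort s (400 * (R + 1) * (nmem s ''n'' 0 + 1))
    (\<lambda>s'. (\<forall>p q. p \<le> q \<longrightarrow> q < nmem s ''n'' 0 \<longrightarrow> lex_le (pts s' p) (pts s' q)) \<and>
       pts s' ` {..<nmem s ''n'' 0} = pts s ` {..<nmem s ''n'' 0})"
proof -
  define n where "n = nmem s ''n'' 0"
  have loop: "runs (While (NLess (nvar ''w'') (nvar ''n'')) merge_pass) s1 (390 * (R + 1) * (n + 1))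
    (\<lambda>s'. (\<forall>p q. p \<le> q \<longrightarrow> q < n \<longrightarrow> lex_le (pts s' p) (pts s' q)) \<and>
       pts s' ` {..<n} = pts s ` {..<n})"
    if s1: "pts s1 = pts s \<and> nmem s1 ''n'' 0 = n \<and> nmem s1 ''w'' 0 = 1" for s1
  \<comment> \<open>The logarithm recovers \<open>r\<close> from \<open>w = 2 ^ r\<close>, so
    doubling lowers the measure by one.\<close>
  proof (rule runs_While[where f = "\<lambda>s'. R - nat \<lfloor>log 2 (nmem s' ''w'' 0)\<rfloor>" and K = "300 * (n + 1)" and
      I = "\<lambda>s'. (\<exists>r. nmem s' ''w'' 0 = 2 ^ r) \<and> block_sorted (nmem s' ''w'' 0) (pts s') n \<and>
        pts s' ` {..<n} = pts s ` {..<n}"], goal_cases)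
    case 1
    then show ?case using s1 by (auto simp: block_sorted_1 intro!: exI[of _ 0])
  next
    case (2 s')
    then have n: "nmem s' ''n'' 0 = n"
      using s1 by (auto simp: unchanged_def merge_pass_def merge_step_def next_block_def emit_def copy_step_def)
    from 2 obtain r where r: "nmem s' ''w'' 0 = 2 ^ r" by blast
    have "2 ^ r < n" using 2(3) n r by simp
    also have "n \<le> 2 ^ R" using R by (simp add: n_def)
    finally have "r < R" by simp
    show ?case
    proof (rule runs_mono[OF merge_pass_runs], goal_cases)
      case (4 s'')
      have w: "nmem s'' ''w'' 0 = 2 ^ Suc r" using 4 r by simp
      have "real (nmem s'' ''w'' 0) = 2 powr real (Suc r)" "real (nmem s' ''w'' 0) = 2 powr real r"
        unfolding w r by (simp_all add: powr_realpow powr_add)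
      then have "nat \<lfloor>log 2 (nmem s'' ''w'' 0)\<rfloor> = Suc r" "nat \<lfloor>log 2 (nmem s' ''w'' 0)\<rfloor> = r"
        by (simp_all only: log_powr_cancel) simp_all
      with 4 w n 2 \<open>r < R\<close> show ?case by (auto intro!: exI[of _ "Suc r"])
    qed (use 2 n r in auto)
  next
    case (3 s')
    then have n: "nmem s' ''n'' 0 = n"
      using s1 by (auto simp: unchanged_def merge_pass_def merge_step_def next_block_def emit_def copy_step_def)
    with 3 show ?case by (auto intro: block_sortedD[where c = 0])
  next
    case 4
    show ?case using s1 by (simp add: algebra_simps)
  qed
  show ?thesis
    unfolding merge_sort_def n_def[symmetric]
    by (rule runs_Seq[where ?T1.0 = 10, OF _ loop])
       (simp_all add: runs_def wp_simps n_def algebra_simps)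
qed

section \<open>The covering program\<close>

text \<open>The key is a function of an index expression, so the same key is evaluated at the loop
  index and at the best index so far. Maxima are found with negated keys.\<close>

definition argmin :: "string \<Rightarrow> (nexp \<Rightarrow> rexp) \<Rightarrow> com" where
  "argmin x e =
     (nset x (NConst 0) ;; nset ''i'' (NConst 0)) ;;
     While (NLess (nvar ''i'') (nvar ''m''))
       (Cond (RLess (e (nvar ''i'')) (e (nvar x))) (nset x (nvar ''i'')) Skip ;; incr ''i'')"

lemma argmin_unchanged:
  "unchanged (argmin x e) s s' \<longleftrightarrow> (\<forall>a. a \<noteq> x \<and> a \<noteq> ''i'' \<longrightarrow> nmem s' a = nmem s a) \<and> rmem s' = rmem s"
  by (auto simp: unchanged_def argmin_def)

text \<open>No reals are written, so \<open>key\<close> can equate the key expression with a fixed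
  function \<open>f\<close> in every state that shares the real memory.\<close>

lemma argmin_runs:
  assumes x: "x \<noteq> ''i''" "x \<noteq> ''m''" and m: "0 < nmem s ''m'' 0"
    and key: "\<And>s' v. rmem s' = rmem s \<Longrightarrow> rval (e (nvar v)) s' = f (nmem s' v 0)"
    and cost: "\<And>v. rcost (e (nvar v)) \<le> 20"
  shows "runs (argmin x e) s (100 * (nmem s ''m'' 0 + 1))
    (\<lambda>s'. nmem s' x 0 < nmem s ''m'' 0 \<and> (\<forall>k < nmem s ''m'' 0. f (nmem s' x 0) \<le> f k) \<and>
      (\<forall>a. a \<noteq> x \<and> a \<noteq> ''i'' \<longrightarrow> nmem s' a = nmem s a) \<and> rmem s' = rmem s)"
proof -
  define n where "n = nmem s ''m'' 0"
  let ?body = "Cond (RLess (e (nvar ''i'')) (e (nvar x))) (nset x (nvar ''i'')) Skip ;; incr ''i''"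
  have loop: "runs (While (NLess (nvar ''i'') (nvar ''m'')) ?body) s1 (80 * (n + 1))
     (\<lambda>s'. nmem s' x 0 < n \<and> (\<forall>k < n. f (nmem s' x 0) \<le> f k))"
    if s1: "nmem s1 x 0 = 0 \<and> nmem s1 ''i'' 0 = 0 \<and> nmem s1 ''m'' 0 = n \<and> rmem s1 = rmem s" for s1
  proof (rule runs_While[where f = "\<lambda>s'. n - nmem s' ''i'' 0" and K = 70 and
        I = "\<lambda>s'. nmem s' ''i'' 0 \<le> n \<and> nmem s' x 0 < n \<and> (\<forall>k < nmem s' ''i'' 0. f (nmem s' x 0) \<le> f k)"], goal_cases)
    case 1
    then show ?case using s1 m by (simp add: n_def)
  next
    case (2 s')
    have c: "rcost (e (nvar ''i'')) + rcost (e (nvar x)) \<le> 40"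
      using cost[of "''i''"] cost[of x] by linarith
    have un: "nmem s' ''m'' = nmem s1 ''m''" "rmem s' = rmem s"
      using 2(2) s1 x by (auto simp: unchanged_def)
    show ?case using 2 x s1 c un by (auto simp: runs_def wp_simps key less_Suc_eq)
  next
    case (3 s')
    have "nmem s' ''m'' = nmem s1 ''m''"
      using 3(2) s1 x by (auto simp: unchanged_def)
    with 3 s1 show ?case by auto
  qed (use s1 in auto)
  have "runs (argmin x e) s (100 * (n + 1)) (\<lambda>s'. nmem s' x 0 < n \<and> (\<forall>k < n. f (nmem s' x 0) \<le> f k))"
    unfolding argmin_def
    by (rule runs_Seq[where ?T1.0 = 20, OF _ loop]) (use x in \<open>auto simp: runs_def wp_simps n_def\<close>)
  then show ?thesis
    by (rule runs_mono[OF runs_unchanged]) (simp_all add: argmin_unchanged n_def)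
qed

section \<open>Cutting into strips\<close>

definition strip_step :: com where
  "strip_step =
     Cond (RLess (RAdd (rvar ''B'') (rvar ''dl'')) (RRead ''b'' (nvar ''i'')))
       (rset ''B'' (RRead ''b'' (nvar ''i''))) Skip ;;
     RWrite ''b'' (nvar ''i'') (rvar ''B'') ;; incr ''i''"

text \<open>The first base is read from cell 0 even if \<open>n = 0\<close>; the loop is then not
  entered.\<close>

definition strips :: com where
  "strips = (nset ''i'' (NConst 0) ;; rset ''B'' (RRead ''b'' (NConst 0))) ;;
     While (NLess (nvar ''i'') (nvar ''n'')) strip_step"

text \<open>The entries below \<open>i\<close> have been rounded down to their strip base; \<open>B\<close> is the
  base of the current strip.\<close>

definition stripped :: "real \<Rightarrow> (nat \<Rightarrow> real) \<Rightarrow> nat \<Rightarrow> nat \<Rightarrow> real \<Rightarrow> (nat \<Rightarrow> real) \<Rightarrow> bool" where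
  "stripped d f n i B g \<longleftrightarrow> i \<le> n \<and> (\<forall>k. i \<le> k \<longrightarrow> k < n \<longrightarrow> g k = f k \<and> B \<le> f k) \<and>
     (\<forall>k<i. g k \<le> f k \<and> f k \<le> g k + d \<and> (g k = B \<or> g k + d < B)) \<and>
     (\<forall>j<i. \<forall>k<i. g j \<noteq> g k \<longrightarrow> d < \<bar>g j - g k\<bar>)"

text \<open>The current base is the largest so far, and a new one exceeds it by more than
  \<open>d\<close>. Comparing with it alone therefore separates the new base from all earlier
  ones.\<close>

lemma stripped_step:
  assumes "stripped d f n i B g" "i < n" "\<And>p q. p \<le> q \<Longrightarrow> q < n \<Longrightarrow> f p \<le> f q" "0 \<le> d"
    "B' = (if B + d < f i then f i else B)"
  shows "stripped d f n (Suc i) B' (g(i := B'))"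
proof -
  have le: "\<forall>k. Suc i \<le> k \<longrightarrow> k < n \<longrightarrow> f i \<le> f k" using assms(3) by simp
  have g: "\<forall>k<i. g k = B' \<or> g k + d < B'"
    using assms unfolding stripped_def by force
  then have sep: "\<forall>k<i. g k \<noteq> B' \<longrightarrow> d < \<bar>g k - B'\<bar> \<and> d < \<bar>B' - g k\<bar>"
    by force
  have B': "B' \<le> f i" "f i \<le> B' + d" "\<forall>k. Suc i \<le> k \<longrightarrow> k < n \<longrightarrow> B' \<le> f k"
    using assms le unfolding stripped_def by auto
  show ?thesis
    unfolding stripped_def
  proof (intro conjI allI impI)
    show "Suc i \<le> n" using assms(2) by simp
  next
    fix k assume "Suc i \<le> k" "k < n"
    with assms(1) B'(3) show "(g(i := B')) k = f k" "B' \<le> f k"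
      by (simp_all add: stripped_def)
  next
    fix k assume "k < Suc i"
    with assms(1) B'(1,2) g show "(g(i := B')) k \<le> f k" "f k \<le> (g(i := B')) k + d"
      "(g(i := B')) k = B' \<or> (g(i := B')) k + d < B'"
      by (cases "k = i"; simp add: stripped_def)+
  next
    fix j k assume "j < Suc i" "k < Suc i" "(g(i := B')) j \<noteq> (g(i := B')) k"
    with assms(1) sep show "d < \<bar>(g(i := B')) j - (g(i := B')) k\<bar>"
      by (cases "k = i"; cases "j = i"; simp add: stripped_def)
  qed
qed

lemma strips_runs:
  assumes sorted: "\<And>p q. p \<le> q \<Longrightarrow> q < nmem s ''n'' 0 \<Longrightarrow> rmem s ''b'' p \<le> rmem s ''b'' q"
    and d: "0 \<le> rmem s ''dl'' 0"
  shows "runs strips s (60 * (nmem s ''n'' 0 + 1)) (\<lambda>s'.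
    (\<forall>k < nmem s ''n'' 0. rmem s' ''b'' k \<le> rmem s ''b'' k \<and> rmem s ''b'' k \<le> rmem s' ''b'' k + rmem s ''dl'' 0) \<and>
    (\<forall>j < nmem s ''n'' 0. \<forall>k < nmem s ''n'' 0. rmem s' ''b'' j \<noteq> rmem s' ''b'' k \<longrightarrow>
        rmem s ''dl'' 0 < \<bar>rmem s' ''b'' j - rmem s' ''b'' k\<bar>))"
proof -
  define n where "n = nmem s ''n'' 0"
  define f where "f = rmem s ''b''"
  define \<delta> where "\<delta> = rmem s ''dl'' 0"
  have srt: "\<And>p q. p \<le> q \<Longrightarrow> q < n \<Longrightarrow> f p \<le> f q" using sorted by (simp add: n_def f_def)
  have loop: "runs (While (NLess (nvar ''i'') (nvar ''n'')) strip_step) s1 (50 * (n + 1))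
     (\<lambda>s'. \<exists>B. stripped \<delta> f n n B (rmem s' ''b''))"
    if s1: "nmem s1 ''i'' 0 = 0 \<and> nmem s1 ''n'' 0 = n \<and> rmem s1 ''b'' = f \<and> rmem s1 ''dl'' 0 = \<delta> \<and> rmem s1 ''B'' 0 = f 0" for s1
  proof (rule runs_While[where f = "\<lambda>s'. n - nmem s' ''i'' 0" and K = 40 and
        I = "\<lambda>s'. stripped \<delta> f n (nmem s' ''i'' 0) (rmem s' ''B'' 0) (rmem s' ''b'')"], goal_cases)
    case 1
    then show ?case using s1 srt by (auto simp: stripped_def)
  next
    case (2 s')
    have un: "nmem s' ''n'' = nmem s1 ''n''" "rmem s' ''dl'' = rmem s1 ''dl''"
      using 2(2) by (auto simp: unchanged_def strip_step_def)
    have lt: "nmem s' ''i'' 0 < n" using 2(3) un s1 by simp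
    then have eq: "rmem s' ''b'' (nmem s' ''i'' 0) = f (nmem s' ''i'' 0)"
      using 2(1) by (auto simp: stripped_def)
    show ?case
      using stripped_step[OF 2(1) lt srt d[folded \<delta>_def] refl] lt s1 un eq
      by (auto simp: runs_def wp_simps strip_step_def)
  next
    case (3 s')
    have un: "nmem s' ''n'' = nmem s1 ''n''"
      using 3(2) by (auto simp: unchanged_def strip_step_def)
    then have "nmem s' ''i'' 0 = n" using 3 s1 by (auto simp: stripped_def)
    with 3(1) show ?case by auto
  qed (use s1 in auto)
  show ?thesis
    unfolding strips_def n_def[symmetric] f_def[symmetric] \<delta>_def[symmetric]
    by (rule runs_mono[OF runs_Seq[where ?T1.0 = 10, OF _ loop order_refl]])
       (auto simp: runs_def wp_simps n_def f_def \<delta>_def stripped_def)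
qed

section \<open>Greedy choice of squares inside the strips\<close>

text \<open>The arrays \<open>ob\<close> and \<open>og\<close> record the coordinates of the squares chosen so far; the
  truncated index \<open>k - 1\<close> is harmless since its entries are ignored if \<open>k = 0\<close>.\<close>

definition select_step :: com where
  "select_step =
     Cond (BAnd (NLess (NConst 0) (nvar ''k''))
            (BAnd (BNot (RLess (RRead ''ob'' (NSub (nvar ''k'') (NConst 1))) (RRead ''b'' (nvar ''i''))))
                  (BNot (RLess (RAdd (RRead ''og'' (NSub (nvar ''k'') (NConst 1))) (rvar ''dl''))
                               (RRead ''g'' (nvar ''i''))))))
       Skip
       (RWrite ''ob'' (nvar ''k'') (RRead ''b'' (nvar ''i'')) ;;
        RWrite ''og'' (nvar ''k'') (RRead ''g'' (nvar ''i'')) ;;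
        RWrite ''ox'' (nvar ''k'') (RSub (RAdd
          (RMul (RDiv (RRead ''g'' (nvar ''i'')) (rvar ''D'')) (rvar ''ux''))
          (RMul (RDiv (RRead ''b'' (nvar ''i'')) (rvar ''D'')) (rvar ''dx''))) (rvar ''mx'')) ;;
        RWrite ''oy'' (nvar ''k'') (RSub (RAdd
          (RMul (RDiv (RRead ''g'' (nvar ''i'')) (rvar ''D'')) (rvar ''uy''))
          (RMul (RDiv (RRead ''b'' (nvar ''i'')) (rvar ''D'')) (rvar ''dy''))) (rvar ''my'')) ;;
        incr ''k'') ;;
     incr ''i''"

definition select :: com where
  "select = (nset ''i'' (NConst 0) ;; nset ''k'' (NConst 0)) ;;
     While (NLess (nvar ''i'') (nvar ''n'')) select_step"

text \<open>Squares are anchored at entries of \<open>f\<close>, so that they inherit the separation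
  of the strip bases.\<close>

definition selected :: "real \<Rightarrow> (nat \<Rightarrow> real \<times> real) \<Rightarrow> nat \<Rightarrow> (nat \<Rightarrow> real \<times> real) \<Rightarrow> nat \<Rightarrow> bool" where
  "selected d f i q k \<longleftrightarrow> (\<forall>l<k. q l \<in> f ` {..<i}) \<and>
     (\<forall>l l'. l < l' \<longrightarrow> l' < k \<longrightarrow> fst (q l) < fst (q l') \<or> fst (q l) = fst (q l') \<and> snd (q l) + d < snd (q l')) \<and>
     (\<forall>j<i. \<exists>l<k. fst (q l) = fst (f j) \<and> snd (q l) \<le> snd (f j) \<and> snd (f j) \<le> snd (q l) + d)"

text \<open>Chosen pairs are ordered with gaps, so a gap to the last one gives a gap to all. By the
  sort order a jump in the second coordinate happens in the same strip or a later one.\<close>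

lemma selected_new:
  assumes s: "selected d f i q k" and srt: "\<And>p. p \<le> i \<Longrightarrow> lex_le (f p) (f i)" and d: "0 \<le> d"
    and new: "k = 0 \<or> fst (q (k - 1)) < fst (f i) \<or> snd (q (k - 1)) + d < snd (f i)"
  shows "selected d f (Suc i) (q(k := f i)) (Suc k)"
proof -
  have sep: "fst (q l) < fst (f i) \<or> fst (q l) = fst (f i) \<and> snd (q l) + d < snd (f i)" if "l < k" for l
  proof -
    have "k - 1 < k" using that by simp
    with s obtain p where "p < i" "q (k - 1) = f p" unfolding selected_def by blast
    then have le: "lex_le (q (k - 1)) (f i)" using srt[of p] by simp
    have last: "fst (q (k - 1)) < fst (f i) \<or> fst (q (k - 1)) = fst (f i) \<and> snd (q (k - 1)) + d < snd (f i)"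
      using le new that unfolding lex_le_def by linarith
    show ?thesis
    proof (cases "l = k - 1")
      case False
      with that have "l < k - 1" "k - 1 < k" by auto
      with s have "fst (q l) < fst (q (k - 1)) \<or> fst (q l) = fst (q (k - 1)) \<and> snd (q l) + d < snd (q (k - 1))"
        unfolding selected_def by blast
      with last d show ?thesis by linarith
    qed (use last in simp)
  qed
  have cov: "\<exists>l<Suc k. fst ((q(k := f i)) l) = fst (f j) \<and> snd ((q(k := f i)) l) \<le> snd (f j) \<and>
      snd (f j) \<le> snd ((q(k := f i)) l) + d" if "j < Suc i" for j
  proof (cases "j = i")
    case True
    with d show ?thesis by (auto intro!: exI[of _ k])
  next
    case False
    with that s obtain l where "l < k" "fst (q l) = fst (f j) \<and> snd (q l) \<le> snd (f j) \<and> snd (f j) \<le> snd (q l) + d"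
      unfolding selected_def by (metis less_SucE)
    then show ?thesis by (auto intro!: exI[of _ l])
  qed
  show ?thesis
    unfolding selected_def
  proof (intro conjI allI impI)
    fix l assume "l < Suc k"
    with s show "(q(k := f i)) l \<in> f ` {..<Suc i}"
      unfolding selected_def lessThan_Suc by (cases "l = k") auto
  next
    fix l l' assume "l < l'" "l' < Suc k"
    with s sep[of l] show "fst ((q(k := f i)) l) < fst ((q(k := f i)) l') \<or>
      fst ((q(k := f i)) l) = fst ((q(k := f i)) l') \<and> snd ((q(k := f i)) l) + d < snd ((q(k := f i)) l')"
      unfolding selected_def by (cases "l' = k") simp_all
  qed (rule cov)
qed

text \<open>\<open>f i\<close> does not precede the last chosen pair, so the failed first comparison
  forces equal strip bases, and the last square already contains \<open>f i\<close>.\<close>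

lemma selected_skip:
  assumes s: "selected d f i q k" and srt: "\<And>p. p \<le> i \<Longrightarrow> lex_le (f p) (f i)"
    and skip: "0 < k" "\<not> fst (q (k - 1)) < fst (f i)" "\<not> snd (q (k - 1)) + d < snd (f i)"
  shows "selected d f (Suc i) q k"
proof -
  have "k - 1 < k" using skip(1) by simp
  with s obtain p where "p < i" "q (k - 1) = f p" unfolding selected_def by blast
  then have "lex_le (q (k - 1)) (f i)" using srt[of p] by simp
  with skip have "\<exists>l<k. fst (q l) = fst (f i) \<and> snd (q l) \<le> snd (f i) \<and> snd (f i) \<le> snd (q l) + d"
    unfolding lex_le_def by (intro exI[of _ "k - 1"] conjI) linarith+
  with s show ?thesis
    unfolding selected_def lessThan_Suc by (simp add: less_Suc_eq)
qed

definition out :: "state \<Rightarrow> nat \<Rightarrow> real \<times> real" where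
  "out s l = (rmem s ''ob'' l, rmem s ''og'' l)"

definition pair :: "state \<Rightarrow> string \<Rightarrow> string \<Rightarrow> point" where
  "pair s a b = (rmem s a 0, rmem s b 0)"

lemma select_runs:
  assumes srt: "\<And>p q. p \<le> q \<Longrightarrow> q < nmem s ''n'' 0 \<Longrightarrow> lex_le (pts s p) (pts s q)"
    and d: "0 \<le> rmem s ''dl'' 0"
  shows "runs select s (150 * (nmem s ''n'' 0 + 1)) (\<lambda>s'.
    \<exists>q k. selected (rmem s ''dl'' 0) (pts s) (nmem s ''n'' 0) q k \<and>
      output_vectors s' = vec (pair s ''ux'' ''uy'') (pair s ''dx'' ''dy'') (pair s ''mx'' ''my'')
        (rmem s ''D'' 0) ` q ` {..<k})"
proof -
  define n where "n = nmem s ''n'' 0"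
  define f where "f = pts s"
  define \<delta> where "\<delta> = rmem s ''dl'' 0"
  define v where "v = vec (pair s ''ux'' ''uy'') (pair s ''dx'' ''dy'') (pair s ''mx'' ''my'') (rmem s ''D'' 0)"
  have srt: "\<And>p q. p \<le> q \<Longrightarrow> q < n \<Longrightarrow> lex_le (f p) (f q)" using srt by (simp add: n_def f_def)
  define I where "I s' \<longleftrightarrow> nmem s' ''i'' 0 \<le> n \<and> selected \<delta> f (nmem s' ''i'' 0) (out s') (nmem s' ''k'' 0) \<and>
    (\<forall>l < nmem s' ''k'' 0. (rmem s' ''ox'' l, rmem s' ''oy'' l) = v (out s' l))" for s'
  have loop: "runs (While (NLess (nvar ''i'') (nvar ''n'')) select_step) s1 (140 * (n + 1))
     (\<lambda>s'. \<exists>q k. selected \<delta> f n q k \<and> output_vectors s' = v ` q ` {..<k})"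
    if s1: "nmem s1 ''i'' 0 = 0 \<and> nmem s1 ''k'' 0 = 0 \<and> nmem s1 ''n'' 0 = n \<and> rmem s1 = rmem s" for s1
  proof (rule runs_While[where f = "\<lambda>s'. n - nmem s' ''i'' 0" and K = 130 and I = I], goal_cases)
    case 1
    then show ?case using s1 by (auto simp: I_def selected_def)
  next
    case (2 s')
    have un1: "nmem s' ''n'' = nmem s1 ''n''"
      by (rule unchanged_n[OF 2(2)]) (simp add: select_step_def)
    have un2: "rmem s' a = rmem s a" if "a \<notin> {''ob'', ''og'', ''ox'', ''oy''}" for a
      using that unchanged_r[OF 2(2), of a] s1 by (simp add: select_step_def)
    have un: "nmem s' ''n'' = nmem s1 ''n''" "rmem s' ''b'' = rmem s ''b''" "rmem s' ''g'' = rmem s ''g''"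
      "rmem s' ''dl'' = rmem s ''dl''" "rmem s' ''D'' = rmem s ''D''" "rmem s' ''ux'' = rmem s ''ux''"
      "rmem s' ''uy'' = rmem s ''uy''" "rmem s' ''dx'' = rmem s ''dx''" "rmem s' ''dy'' = rmem s ''dy''"
      "rmem s' ''mx'' = rmem s ''mx''" "rmem s' ''my'' = rmem s ''my''"
      using un1 un2 by simp_all
    have lt: "nmem s' ''i'' 0 < n" using 2(3) un(1) s1 by simp
    define i k where "i = nmem s' ''i'' 0" and "k = nmem s' ''k'' 0"
    have sel: "selected \<delta> f i (out s') k" and o: "\<And>l. l < k \<Longrightarrow> (rmem s' ''ox'' l, rmem s' ''oy'' l) = v (out s' l)"
      using 2(1) by (auto simp: I_def i_def k_def)
    have fi: "f i = (rmem s ''b'' i, rmem s ''g'' i)" by (simp add: f_def pts_def)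
    have le: "\<And>p. p \<le> i \<Longrightarrow> lex_le (f p) (f i)" using srt lt by (simp add: i_def)
    let ?b = "0 < k \<and> \<not> fst (out s' (k - 1)) < fst (f i) \<and> \<not> snd (out s' (k - 1)) + \<delta> < snd (f i)"
    show ?case
    proof (cases ?b)
      case True
      from selected_skip[OF sel le] True have new: "selected \<delta> f (Suc i) (out s') k" by auto
      from True have b: "0 < k" "\<not> rmem s' ''ob'' (k - 1) < rmem s ''b'' i"
          "\<not> rmem s' ''og'' (k - 1) + \<delta> < rmem s ''g'' i"
        by (simp_all add: out_def fi)
      have "runs select_step s' 130 (\<lambda>s2. nmem s2 ''i'' 0 = Suc i \<and> nmem s2 ''k'' 0 = k \<and> rmem s2 = rmem s')"
        using b unfolding i_def k_def
        by (simp add: runs_def wp_simps select_step_def un \<delta>_def[symmetric])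
      then show ?thesis
      proof (rule runs_mono[OF _ order_refl], goal_cases)
        case (1 s2)
        then have "out s2 = out s'" by (simp add: out_def fun_eq_iff)
        with 1 new lt o show ?case
          by (auto simp: I_def i_def[symmetric])
      qed
    next
      case False
      with selected_new[OF sel le d[folded \<delta>_def]]
      have new: "selected \<delta> f (Suc i) ((out s')(k := f i)) (Suc k)" by auto
      from False have b: "\<not> (0 < k \<and> \<not> rmem s' ''ob'' (k - 1) < rmem s ''b'' i \<and> \<not> rmem s' ''og'' (k - 1) + \<delta> < rmem s ''g'' i)"
        by (auto simp: out_def fi)
      \<comment> \<open>\<open>vec\<close> by coordinates, in the form that the program
        evaluates.\<close>
      have vi: "v (f i) =
        (rmem s ''g'' i / rmem s ''D'' 0 * rmem s ''ux'' 0 + rmem s ''b'' i / rmem s ''D'' 0 * rmem s ''dx'' 0 - rmem s ''mx'' 0,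
         rmem s ''g'' i / rmem s ''D'' 0 * rmem s ''uy'' 0 + rmem s ''b'' i / rmem s ''D'' 0 * rmem s ''dy'' 0 - rmem s ''my'' 0)"
        by (simp add: v_def vec_def pair_def fi)
      have "runs select_step s' 130 (\<lambda>s2. nmem s2 ''i'' 0 = Suc i \<and> nmem s2 ''k'' 0 = Suc k \<and>
          rmem s2 ''ob'' = (rmem s' ''ob'')(k := rmem s ''b'' i) \<and> rmem s2 ''og'' = (rmem s' ''og'')(k := rmem s ''g'' i) \<and>
          rmem s2 ''ox'' = (rmem s' ''ox'')(k := fst (v (f i))) \<and> rmem s2 ''oy'' = (rmem s' ''oy'')(k := snd (v (f i))))"
        using b unfolding i_def k_def vi[unfolded i_def]
        by (simp add: runs_def wp_simps select_step_def un \<delta>_def[symmetric])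
      then show ?thesis
      proof (rule runs_mono[OF _ order_refl], goal_cases)
        case (1 s2)
        then have out: "out s2 = (out s')(k := f i)" by (simp add: out_def fun_eq_iff fi)
        have "(rmem s2 ''ox'' l, rmem s2 ''oy'' l) = v (out s2 l)" if "l < Suc k" for l
          using that o[of l] 1 out by (cases "l = k") auto
        with out 1 new lt show ?case
          by (simp add: I_def i_def[symmetric])
      qed
    qed
  next
    case (3 s')
    have un: "nmem s' ''n'' = nmem s1 ''n''"
      using 3(2) by (auto simp: unchanged_def select_step_def)
    then have "nmem s' ''i'' 0 = n" using 3 s1 by (auto simp: I_def)
    with 3(1) have sel: "selected \<delta> f n (out s') (nmem s' ''k'' 0)"
      and o: "\<And>l. l < nmem s' ''k'' 0 \<Longrightarrow> (rmem s' ''ox'' l, rmem s' ''oy'' l) = v (out s' l)"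
      by (simp_all add: I_def)
    have "output_vectors s' = (\<lambda>l. (rmem s' ''ox'' l, rmem s' ''oy'' l)) ` {..<nmem s' ''k'' 0}"
      by (auto simp: output_vectors_def)
    also have "\<dots> = v ` out s' ` {..<nmem s' ''k'' 0}"
      unfolding image_image using o by (intro image_cong) auto
    finally show ?case using sel by blast
  qed (use s1 in auto)
  show ?thesis
    unfolding select_def n_def[symmetric] f_def[symmetric] \<delta>_def[symmetric] v_def[symmetric]
    by (rule runs_Seq[where ?T1.0 = 10, OF _ loop]) (auto simp: runs_def wp_simps n_def)
qed

section \<open>Choosing the directions \<open>u\<close> and \<open>d\<close> from extreme
  vertices\<close>

definition cross_key :: "nexp \<Rightarrow> rexp" where
  "cross_key i = RSub (RMul (rvar ''ux'') (RRead ''vy'' i)) (RMul (rvar ''uy'') (RRead ''vx'' i))"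

definition choose_chord :: com where
  "choose_chord =
     argmin ''l'' (RRead ''vx'') ;;
     argmin ''r'' (\<lambda>i. RSub (RConst 0) (RRead ''vx'' i)) ;;
     rset ''ux'' (RSub (RRead ''vx'' (nvar ''r'')) (RRead ''vx'' (nvar ''l''))) ;;
     rset ''uy'' (RSub (RRead ''vy'' (nvar ''r'')) (RRead ''vy'' (nvar ''l'')))"

definition choose_width :: com where
  "choose_width =
     argmin ''s'' cross_key ;;
     argmin ''t'' (\<lambda>i. RSub (RConst 0) (cross_key i)) ;;
     rset ''dx'' (RSub (RRead ''vx'' (nvar ''t'')) (RRead ''vx'' (nvar ''s''))) ;;
     rset ''dy'' (RSub (RRead ''vy'' (nvar ''t'')) (RRead ''vy'' (nvar ''s''))) ;;
     rset ''D'' (RSub (RMul (rvar ''ux'') (rvar ''dy'')) (RMul (rvar ''uy'') (rvar ''dx''))) ;;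
     rset ''dl'' (RDiv (rvar ''D'') (RConst 2)) ;;
     rset ''mx'' (RDiv (RAdd (RRead ''vx'' (nvar ''l'')) (RRead ''vx'' (nvar ''s''))) (RConst 2)) ;;
     rset ''my'' (RDiv (RAdd (RRead ''vy'' (nvar ''l'')) (RRead ''vy'' (nvar ''s''))) (RConst 2))"

definition verts :: "state \<Rightarrow> nat \<Rightarrow> point" where
  "verts s k = (rmem s ''vx'' k, rmem s ''vy'' k)"

definition inputs :: "state \<Rightarrow> nat \<Rightarrow> point" where
  "inputs s k = (rmem s ''px'' k, rmem s ''py'' k)"

lemma choose_chord_runs:
  assumes m: "0 < nmem s ''m'' 0"
  shows "runs choose_chord s (300 * (nmem s ''m'' 0 + 1)) (\<lambda>s'.
    nmem s' ''l'' 0 < nmem s ''m'' 0 \<and> nmem s' ''r'' 0 < nmem s ''m'' 0 \<and>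
    (\<forall>k < nmem s ''m'' 0. fst (verts s (nmem s' ''l'' 0)) \<le> fst (verts s k) \<and>
        fst (verts s k) \<le> fst (verts s (nmem s' ''r'' 0))) \<and>
    pair s' ''ux'' ''uy'' = verts s (nmem s' ''r'' 0) - verts s (nmem s' ''l'' 0))"
  unfolding choose_chord_def
proof (rule runs_Seq[where ?T2.0 = "200 * (nmem s ''m'' 0 + 1)",
      OF argmin_runs[where f = "\<lambda>k. rmem s ''vx'' k"]], goal_cases)
  case (6 s1)
  then have s1: "rmem s1 = rmem s" "nmem s1 ''m'' = nmem s ''m''" by simp_all
  show ?case
  proof (rule runs_Seq[where ?T2.0 = 50, OF argmin_runs[where f = "\<lambda>k. - rmem s ''vx'' k"]], goal_cases)
    case (6 s2)
    with \<open>rmem s1 = rmem s\<close> have "rmem s2 = rmem s" "nmem s2 ''l'' = nmem s1 ''l''" by simp_all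
    with 6 \<open>_ \<and> (\<forall>k<nmem s ''m'' 0. rmem s ''vx'' _ \<le> _) \<and> _\<close> s1 show ?case
      by (simp add: runs_def wp_simps verts_def pair_def)
  qed (use m s1 in simp_all)
qed (use m in simp_all)

text \<open>The extreme vertices stay existential, since later phases read only the values derived
  from them.\<close>

lemma choose_width_runs:
  assumes m: "0 < nmem s ''m'' 0"
  shows "runs choose_width s (300 * (nmem s ''m'' 0 + 1)) (\<lambda>s'.
    \<exists>i < nmem s ''m'' 0. \<exists>j < nmem s ''m'' 0.
      (\<forall>k < nmem s ''m'' 0. cross (pair s ''ux'' ''uy'') (verts s i) \<le> cross (pair s ''ux'' ''uy'') (verts s k) \<and>
        cross (pair s ''ux'' ''uy'') (verts s k) \<le> cross (pair s ''ux'' ''uy'') (verts s j)) \<and>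
      pair s' ''dx'' ''dy'' = verts s j - verts s i \<and>
      rmem s' ''D'' 0 = cross (pair s ''ux'' ''uy'') (verts s j - verts s i) \<and>
      rmem s' ''dl'' 0 = cross (pair s ''ux'' ''uy'') (verts s j - verts s i) / 2 \<and>
      pair s' ''mx'' ''my'' = (1 / 2) *\<^sub>R (verts s (nmem s ''l'' 0) + verts s i))"
proof -
  let ?f = "\<lambda>k. cross (pair s ''ux'' ''uy'') (verts s k)"
  have key: "rval (cross_key (nvar v)) s' = ?f (nmem s' v 0)" if "rmem s' = rmem s" for s' v
    using that by (simp add: cross_key_def cross_def pair_def verts_def)
  have cost: "rcost (cross_key (nvar v)) = 13" for v
    by (simp add: cross_key_def)
  show ?thesis
    unfolding choose_width_def
  proof (rule runs_Seq[where ?T2.0 = "200 * (nmem s ''m'' 0 + 1)", OF argmin_runs[where f = ?f]], goal_cases)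
    case (6 s1)
    then have s1: "rmem s1 = rmem s" "nmem s1 ''m'' = nmem s ''m''" "nmem s1 ''l'' = nmem s ''l''"
      "nmem s1 ''s'' 0 < nmem s ''m'' 0" "\<forall>k<nmem s ''m'' 0. ?f (nmem s1 ''s'' 0) \<le> ?f k" by simp_all
    show ?case
    proof (rule runs_Seq[where ?T2.0 = 100, OF argmin_runs[where f = "\<lambda>k. - ?f k"]], goal_cases)
      case (6 s2)
      with s1 have s2: "rmem s2 = rmem s" "nmem s2 ''l'' = nmem s ''l''" "nmem s2 ''s'' = nmem s1 ''s''"
        "nmem s2 ''t'' 0 < nmem s ''m'' 0" "\<forall>k<nmem s ''m'' 0. ?f k \<le> ?f (nmem s2 ''t'' 0)" by simp_all
      define i j where "i = nmem s1 ''s'' 0" and "j = nmem s2 ''t'' 0"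
      let ?u = "pair s ''ux'' ''uy''"
      have "runs (rset ''dx'' (RSub (RRead ''vx'' (nvar ''t'')) (RRead ''vx'' (nvar ''s''))) ;;
         rset ''dy'' (RSub (RRead ''vy'' (nvar ''t'')) (RRead ''vy'' (nvar ''s''))) ;;
         rset ''D'' (RSub (RMul (rvar ''ux'') (rvar ''dy'')) (RMul (rvar ''uy'') (rvar ''dx''))) ;;
         rset ''dl'' (RDiv (rvar ''D'') (RConst 2)) ;;
         rset ''mx'' (RDiv (RAdd (RRead ''vx'' (nvar ''l'')) (RRead ''vx'' (nvar ''s''))) (RConst 2)) ;;
         rset ''my'' (RDiv (RAdd (RRead ''vy'' (nvar ''l'')) (RRead ''vy'' (nvar ''s''))) (RConst 2))) s2 100
         (\<lambda>s'. pair s' ''dx'' ''dy'' = verts s j - verts s i \<and>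
           rmem s' ''D'' 0 = cross ?u (verts s j - verts s i) \<and>
           rmem s' ''dl'' 0 = cross ?u (verts s j - verts s i) / 2 \<and>
           pair s' ''mx'' ''my'' = (1 / 2) *\<^sub>R (verts s (nmem s ''l'' 0) + verts s i))"
        by (simp add: runs_def wp_simps pair_def verts_def s2 cross_def i_def j_def)
      then show ?case
        by (rule runs_mono[OF _ order_refl]) (use s1 s2 in \<open>auto simp: i_def j_def\<close>)
    next
      case (4 s' v)
      with s1 key[of s' v] show ?case by simp
    qed (use m s1 cost in simp_all)
  next
    case (4 s' v)
    with key[of s' v] show ?case by simp
  qed (use m cost in simp_all)
qed

section \<open>Passing to linear coordinates\<close>

definition transform_step :: com where
  "transform_step =
     RWrite ''b'' (nvar ''i'') (RSub (RMul (rvar ''ux'') (RRead ''py'' (nvar ''i'')))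
                                     (RMul (rvar ''uy'') (RRead ''px'' (nvar ''i'')))) ;;
     RWrite ''g'' (nvar ''i'') (RSub (RMul (RRead ''px'' (nvar ''i'')) (rvar ''dy''))
                                     (RMul (RRead ''py'' (nvar ''i'')) (rvar ''dx''))) ;;
     incr ''i''"

definition transform :: com where
  "transform = nset ''i'' (NConst 0) ;; While (NLess (nvar ''i'') (nvar ''n'')) transform_step"

lemma transform_runs:
  "runs transform s (70 * (nmem s ''n'' 0 + 1)) (\<lambda>s'. \<forall>k < nmem s ''n'' 0. pts s' k =
     (cross (pair s ''ux'' ''uy'') (inputs s k), cross (inputs s k) (pair s ''dx'' ''dy'')))"
proof -
  define n where "n = nmem s ''n'' 0"
  define f where "f k = (cross (pair s ''ux'' ''uy'') (inputs s k), cross (inputs s k) (pair s ''dx'' ''dy''))" for k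
  have loop: "runs (While (NLess (nvar ''i'') (nvar ''n'')) transform_step) s1 (60 * (n + 1))
     (\<lambda>s'. \<forall>k < n. pts s' k = f k)"
    if s1: "nmem s1 ''i'' 0 = 0 \<and> nmem s1 ''n'' 0 = n \<and> rmem s1 = rmem s" for s1
  proof (rule runs_While[where f = "\<lambda>s'. n - nmem s' ''i'' 0" and K = 50 and
        I = "\<lambda>s'. nmem s' ''i'' 0 \<le> n \<and> (\<forall>k < nmem s' ''i'' 0. pts s' k = f k)"], goal_cases)
    case (2 s')
    have un: "nmem s' ''n'' = nmem s1 ''n''" "rmem s' ''px'' = rmem s ''px''" "rmem s' ''py'' = rmem s ''py''"
      "rmem s' ''ux'' = rmem s ''ux''" "rmem s' ''uy'' = rmem s ''uy''"
      "rmem s' ''dx'' = rmem s ''dx''" "rmem s' ''dy'' = rmem s ''dy''"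
      using 2(2) s1 by (simp_all add: unchanged_def transform_step_def)
    with 2 s1 show ?case
      by (simp add: runs_def wp_simps transform_step_def pts_rwrite2 less_Suc_eq f_def cross_def pair_def inputs_def)
  next
    case (3 s')
    then have "nmem s' ''n'' = nmem s1 ''n''"
      by (simp add: unchanged_def transform_step_def)
    with 3 s1 show ?case by auto
  qed (use s1 in auto)
  show ?thesis
    unfolding transform_def n_def[symmetric] f_def[symmetric]
    by (rule runs_Seq[where ?T1.0 = 10, OF _ loop]) (simp_all add: runs_def wp_simps n_def)
qed

text \<open>\<open>strips\<close> overwrites first coordinates by strip bases. The second run of the
  same lexicographic sort thus groups the strips and orders each by the second coordinate.\<close>

definition cover_program :: com where
  "cover_program = choose_chord ;; choose_width ;; transform ;; merge_sort ;; strips ;; merge_sort ;; select"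

section \<open>Composing the phases\<close>

lemma merge_sort_writes:
  "nwrites merge_sort = {''w'', ''h'', ''i'', ''e'', ''j'', ''o''}"
  "rwrites merge_sort = {''tb'', ''tg'', ''b'', ''g''}"
  by (auto simp: merge_sort_def merge_pass_def merge_step_def next_block_def emit_def copy_step_def)

definition separated :: "real \<Rightarrow> (real \<times> real) set \<Rightarrow> bool" where
  "separated e Q \<longleftrightarrow> (\<forall>x \<in> Q. \<forall>y \<in> Q. (fst x \<noteq> fst y \<longrightarrow> e < \<bar>fst x - fst y\<bar>) \<and>
     (fst x = fst y \<longrightarrow> x \<noteq> y \<longrightarrow> e < \<bar>snd x - snd y\<bar>))"

text \<open>Bases of squares are bases of points, separated by \<open>sep\<close>; inside a strip
  the selection order provides the gap, whichever index comes first.\<close>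

lemma selected_separated:
  assumes sel: "selected e f n q k"
    and sep: "\<And>i j. i < n \<Longrightarrow> j < n \<Longrightarrow> fst (f i) \<noteq> fst (f j) \<Longrightarrow> e < \<bar>fst (f i) - fst (f j)\<bar>"
  shows "separated e (q ` {..<k})"
  unfolding separated_def
proof (intro ballI conjI impI)
  fix x y assume "x \<in> q ` {..<k}" "y \<in> q ` {..<k}" "fst x \<noteq> fst y"
  moreover have "q ` {..<k} \<subseteq> f ` {..<n}" using sel unfolding selected_def by blast
  ultimately obtain i j where "i < n" "j < n" "x = f i" "y = f j" by blast
  with \<open>fst x \<noteq> fst y\<close> sep[of i j] show "e < \<bar>fst x - fst y\<bar>" by simp
next
  fix x y assume xy: "x \<in> q ` {..<k}" "y \<in> q ` {..<k}" "fst x = fst y" "x \<noteq> y"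
  have "\<forall>i j. i < j \<longrightarrow> j < k \<longrightarrow>
      fst (q i) < fst (q j) \<or> fst (q i) = fst (q j) \<and> snd (q i) + e < snd (q j)"
    using sel unfolding selected_def by (elim conjE)
  then have gap: "snd (q i) + e < snd (q j)" if "i < j" "j < k" "fst (q i) = fst (q j)" for i j
    using that by (metis less_irrefl)
  from xy(1,2) obtain i j where ij: "i < k" "j < k" "x = q i" "y = q j" by blast
  with xy have "i < j \<or> j < i" by (cases i j rule: linorder_cases) auto
  with ij gap[of i j] gap[of j i] xy(3) have "snd x + e < snd y \<or> snd y + e < snd x"
    by auto
  then show "e < \<bar>snd x - snd y\<bar>" by linarith
qed

text \<open>The second sort permutes the pairs (strip base, second coordinate) produced by \<open>strips\<close>.\<close>

lemma sort_select_runs: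
  fixes s :: state and u d c :: point and D :: real and R :: nat
  defines "n \<equiv> nmem s ''n'' 0"
  assumes frame: "pair s ''ux'' ''uy'' = u" "pair s ''dx'' ''dy'' = d" "pair s ''mx'' ''my'' = c"
      "rmem s ''D'' 0 = D" "rmem s ''dl'' 0 = D / 2" "0 \<le> D"
    and R: "n \<le> 2 ^ R"
  shows "runs (merge_sort ;; strips ;; merge_sort ;; select) s (1010 * (R + 1) * (n + 1)) (\<lambda>s'.
    \<exists>Q. finite Q \<and> separated (D / 2) Q \<and> output_vectors s' = vec u d c D ` Q \<and>
      (\<forall>k<n. \<exists>x\<in>Q. fst x \<le> fst (pts s k) \<and> fst (pts s k) \<le> fst x + D / 2 \<and>
         snd x \<le> snd (pts s k) \<and> snd (pts s k) \<le> snd x + D / 2))"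
    (is "runs _ _ _ ?post")
proof -
  \<comment> \<open>\<open>K\<close> collects the values that sorting and strip cutting leave alone
    and that the later phases read.\<close>
  define K where "K s' \<longleftrightarrow> nmem s' ''n'' 0 = n \<and> pair s' ''ux'' ''uy'' = u \<and> pair s' ''dx'' ''dy'' = d \<and>
    pair s' ''mx'' ''my'' = c \<and> rmem s' ''D'' 0 = D \<and> rmem s' ''dl'' 0 = D / 2" for s'
  have K: "K s" using frame by (simp add: K_def n_def)
  have K_sort: "K s'" if "K s''" "unchanged merge_sort s'' s'" for s' s''
    using that by (simp add: K_def unchanged_def merge_sort_writes pair_def)
  have K_strips: "K s'" "rmem s' ''g'' = rmem s'' ''g''" if "K s''" "unchanged strips s'' s'" for s' s''
    using that by (simp_all add: K_def unchanged_def strips_def strip_step_def pair_def)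
  have sort: "runs merge_sort s' (400 * (R + 1) * (n + 1))
    (\<lambda>s''. (\<forall>p q. p \<le> q \<longrightarrow> q < n \<longrightarrow> lex_le (pts s'' p) (pts s'' q)) \<and>
       pts s'' ` {..<n} = pts s' ` {..<n} \<and> K s'')" if "K s'" for s'
    by (rule runs_mono[OF runs_unchanged[OF merge_sort_runs[of _ R]]])
       (use that R K_sort[OF that] in \<open>simp_all add: K_def\<close>)
  \<comment> \<open>A common unit for the budgets: \<open>1010 = 400 + 60 + 400 + 150\<close>, in
    the order of the phases.\<close>
  define T where "T = (R + 1) * (n + 1)"
  have T: "n + 1 \<le> T" by (simp add: T_def)
  have "runs (merge_sort ;; strips ;; merge_sort ;; select) s (1010 * T) ?post"
  proof (rule runs_Seq[where ?T2.0 = "610 * T", OF sort[OF K]], goal_cases)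
    case (1 s1)
    then have s1: "\<And>p q. p \<le> q \<Longrightarrow> q < n \<Longrightarrow> lex_le (pts s1 p) (pts s1 q)"
      "pts s1 ` {..<n} = pts s ` {..<n}" and K1: "K s1" by simp_all
    have n1: "nmem s1 ''n'' 0 = n" "rmem s1 ''dl'' 0 = D / 2" using K1 by (simp_all add: K_def)
    have b1: "rmem s1 ''b'' p \<le> rmem s1 ''b'' q" if "p \<le> q" "q < n" for p q
      using s1(1)[OF that] by (auto simp: lex_le_def pts_def)
    show ?case
    proof (rule runs_Seq[where ?T2.0 = "550 * T", OF runs_unchanged[OF strips_runs]], goal_cases)
      case (3 s2)
      then have K2: "K s2" and g2: "rmem s2 ''g'' = rmem s1 ''g''"
        using K_strips K1 by blast+
      have b2: "\<And>k. k < n \<Longrightarrow> rmem s2 ''b'' k \<le> rmem s1 ''b'' k \<and> rmem s1 ''b'' k \<le> rmem s2 ''b'' k + D / 2"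
        "\<And>j k. j < n \<Longrightarrow> k < n \<Longrightarrow> rmem s2 ''b'' j \<noteq> rmem s2 ''b'' k \<Longrightarrow>
          D / 2 < \<bar>rmem s2 ''b'' j - rmem s2 ''b'' k\<bar>"
        using 3 unfolding n1 by blast+
      show ?case
      proof (rule runs_Seq[where ?T2.0 = "150 * T", OF sort[OF K2]], goal_cases)
        case (1 s3)
        then have s3: "\<And>p q. p \<le> q \<Longrightarrow> q < n \<Longrightarrow> lex_le (pts s3 p) (pts s3 q)"
          "pts s3 ` {..<n} = pts s2 ` {..<n}" and K3: "K s3" by simp_all
        have n3: "nmem s3 ''n'' 0 = n" "rmem s3 ''dl'' 0 = D / 2" "rmem s3 ''D'' 0 = D"
          "pair s3 ''ux'' ''uy'' = u" "pair s3 ''dx'' ''dy'' = d" "pair s3 ''mx'' ''my'' = c"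
          using K3 by (simp_all add: K_def)
        show ?case
        proof (rule runs_mono[OF select_runs], goal_cases)
          case (4 s4)
          then obtain q k where sel: "selected (D / 2) (pts s3) n q k"
            and out: "output_vectors s4 = vec u d c D ` q ` {..<k}"
            unfolding n3 by blast
          have "separated (D / 2) (q ` {..<k})"
          proof (rule selected_separated[OF sel])
            fix i j assume ij: "i < n" "j < n" "fst (pts s3 i) \<noteq> fst (pts s3 j)"
            then have "pts s3 i \<in> pts s2 ` {..<n}" "pts s3 j \<in> pts s2 ` {..<n}"
              using s3(2) by blast+
            then obtain i' j' where "i' < n" "j' < n" "pts s3 i = pts s2 i'" "pts s3 j = pts s2 j'" by blast
            with ij(3) b2(2)[of i' j'] show "D / 2 < \<bar>fst (pts s3 i) - fst (pts s3 j)\<bar>"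
              by (simp add: pts_def)
          qed
          moreover have "\<exists>x\<in>q ` {..<k}. fst x \<le> fst (pts s j) \<and> fst (pts s j) \<le> fst x + D / 2 \<and>
             snd x \<le> snd (pts s j) \<and> snd (pts s j) \<le> snd x + D / 2" if "j < n" for j
          proof -
            \<comment> \<open>The point is followed through the first sort, the rounding to its
              strip base and the second sort.\<close>
            have "pts s j \<in> pts s1 ` {..<n}" using that s1(2) by blast
            then obtain i where i: "i < n" "pts s j = pts s1 i" by blast
            have "pts s2 i \<in> pts s3 ` {..<n}" using i(1) s3(2) by blast
            then obtain i' where i': "i' < n" "pts s2 i = pts s3 i'" by blast
            with sel obtain l where "l < k" "fst (q l) = fst (pts s2 i)" "snd (q l) \<le> snd (pts s2 i)"
              "snd (pts s2 i) \<le> snd (q l) + D / 2"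
              unfolding selected_def by metis
            with b2(1)[OF i(1)] i(2) g2 show ?thesis
              by (intro bexI[of _ "q l"]) (simp_all add: pts_def)
          qed
          ultimately show ?case using out by blast
        qed (use s3 n3 frame T in simp_all)
      qed (use T in \<open>simp add: T_def algebra_simps\<close>)
    qed (use b1 n1 frame T in simp_all)
  qed (simp add: T_def algebra_simps)
  then show ?thesis by (simp only: T_def mult.assoc)
qed

text \<open>The contract between program and geometry, free of machine states: \<open>Q\<close>
  holds the lower corners of the squares in linear coordinates.\<close>

definition square_cover :: "point list \<Rightarrow> point set \<Rightarrow> point set \<Rightarrow> bool" where
  "square_cover vs P S \<longleftrightarrow> (\<exists>l\<in>set vs. \<exists>r\<in>set vs. \<exists>a\<in>set vs. \<exists>t\<in>set vs. \<exists>Q.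
     (\<forall>v\<in>set vs. fst l \<le> fst v \<and> fst v \<le> fst r \<and>
       cross (r - l) a \<le> cross (r - l) v \<and> cross (r - l) v \<le> cross (r - l) t) \<and>
     finite Q \<and> separated (cross (r - l) (t - a) / 2) Q \<and>
     S = vec (r - l) (t - a) ((1 / 2) *\<^sub>R (l + a)) (cross (r - l) (t - a)) ` Q \<and>
     (\<forall>p\<in>P. \<exists>x\<in>Q. fst x \<le> cross (r - l) p \<and> cross (r - l) p \<le> fst x + cross (r - l) (t - a) / 2 \<and>
        snd x \<le> cross p (t - a) \<and> cross p (t - a) \<le> snd x + cross (r - l) (t - a) / 2))"

text \<open>Each of the two choosing phases costs \<open>300 * (m + 1)\<close>;
  \<open>1080 = 70 + 1010\<close> accounts for \<open>transform\<close> and for sorting and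
  selecting.\<close>

lemma cover_program_runs:
  assumes vs: "vs \<noteq> []" and R: "length ps \<le> 2 ^ R"
  shows "runs cover_program (input_state ps vs)
    (600 * (length vs + 1) + 1080 * (R + 1) * (length ps + 1))
    (\<lambda>s'. square_cover vs (set ps) (output_vectors s'))"
    (is "runs _ ?s _ ?post")
proof -
  define n m where "n = length ps" and "m = length vs"
  have m: "0 < m" using vs by (simp add: m_def)
  define V where "V = verts ?s"
  have s: "nmem ?s ''n'' 0 = n" "nmem ?s ''m'' 0 = m"
    by (simp_all add: input_state_def n_def m_def)
  have V: "V k = vs ! k" if "k < m" for k
    using that by (simp add: V_def verts_def input_state_def array_of_def m_def)
  have P: "inputs ?s k = ps ! k" if "k < n" for k
    using that by (simp add: inputs_def input_state_def array_of_def n_def)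
  define T where "T = (R + 1) * (n + 1)"
  have T: "n + 1 \<le> T" by (simp add: T_def)
  have "runs cover_program ?s (600 * (m + 1) + 1080 * T) ?post"
    unfolding cover_program_def
  proof (rule runs_Seq[where ?T2.0 = "300 * (m + 1) + 1080 * T",
        OF runs_unchanged[OF choose_chord_runs]], goal_cases)
    case (2 s1)
    define l r where "l = V (nmem s1 ''l'' 0)" and "r = V (nmem s1 ''r'' 0)"
    have chord: "nmem s1 ''l'' 0 < m" "nmem s1 ''r'' 0 < m" "\<forall>k<m. fst l \<le> fst (V k) \<and> fst (V k) \<le> fst r"
      "pair s1 ''ux'' ''uy'' = r - l"
      using 2 s by (simp_all add: l_def r_def V_def)
    have un1: "nmem s1 ''n'' 0 = n" "nmem s1 ''m'' 0 = m" "verts s1 = V" "inputs s1 = inputs ?s"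
      using 2 s by (simp_all add: unchanged_def choose_chord_def argmin_def V_def verts_def inputs_def fun_eq_iff)
    show ?case
    proof (rule runs_Seq[where ?T2.0 = "1080 * T", OF runs_unchanged[OF choose_width_runs]], goal_cases)
      case (2 s2)
      then obtain i j where ij: "i < m" "j < m"
        "\<forall>k<m. cross (r - l) (V i) \<le> cross (r - l) (V k) \<and> cross (r - l) (V k) \<le> cross (r - l) (V j)"
        "pair s2 ''dx'' ''dy'' = V j - V i" "rmem s2 ''D'' 0 = cross (r - l) (V j - V i)"
        "rmem s2 ''dl'' 0 = cross (r - l) (V j - V i) / 2"
        "pair s2 ''mx'' ''my'' = (1 / 2) *\<^sub>R (l + V i)"
        unfolding un1 chord(4) l_def[symmetric] by blast
      define a t where "a = V i" and "t = V j"
      define D where "D = cross (r - l) (t - a)"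
      have D: "0 \<le> D" using ij(1,3) by (simp add: D_def cross_simps a_def t_def)
      have un2: "nmem s2 ''n'' 0 = n" "inputs s2 = inputs ?s" "pair s2 ''ux'' ''uy'' = r - l"
        using 2 un1 chord(4)
        by (simp_all add: unchanged_def choose_width_def argmin_def inputs_def pair_def fun_eq_iff)
      show ?case
      proof (rule runs_Seq[where ?T2.0 = "1010 * T", OF runs_unchanged[OF transform_runs]], goal_cases)
        case (1 s3)
        have un3: "nmem s3 ''n'' 0 = n" "pair s3 ''ux'' ''uy'' = r - l" "pair s3 ''dx'' ''dy'' = t - a"
          "pair s3 ''mx'' ''my'' = (1 / 2) *\<^sub>R (l + a)" "rmem s3 ''D'' 0 = D" "rmem s3 ''dl'' 0 = D / 2"
          using 1 un2 ij(4-7)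
          by (simp_all add: unchanged_def transform_def transform_step_def pair_def a_def t_def D_def)
        have pts: "pts s3 k = (cross (r - l) (ps ! k), cross (ps ! k) (t - a))" if "k < n" for k
          using 1 that P un2 ij(4) by (simp add: a_def t_def)
        have "runs (merge_sort ;; strips ;; merge_sort ;; select) s3 (1010 * (R + 1) * (n + 1)) (\<lambda>s'.
          \<exists>Q. finite Q \<and> separated (D / 2) Q \<and> output_vectors s' = vec (r - l) (t - a) ((1 / 2) *\<^sub>R (l + a)) D ` Q \<and>
            (\<forall>k<n. \<exists>x\<in>Q. fst x \<le> fst (pts s3 k) \<and> fst (pts s3 k) \<le> fst x + D / 2 \<and>
               snd x \<le> snd (pts s3 k) \<and> snd (pts s3 k) \<le> snd x + D / 2))"
          using sort_select_runs[OF un3(2-6) D, of R] R unfolding un3(1) n_def by blast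
        then show ?case
        proof (rule runs_mono, goal_cases)
          case 1
          show ?case by (simp only: T_def mult.assoc)
        next
          case (2 s4)
          then obtain Q where Q: "finite Q" "separated (D / 2) Q"
              "output_vectors s4 = vec (r - l) (t - a) ((1 / 2) *\<^sub>R (l + a)) D ` Q"
            and cov: "\<And>k. k < n \<Longrightarrow> \<exists>x\<in>Q. fst x \<le> fst (pts s3 k) \<and> fst (pts s3 k) \<le> fst x + D / 2 \<and>
               snd x \<le> snd (pts s3 k) \<and> snd (pts s3 k) \<le> snd x + D / 2"
            by blast
          have "\<exists>x\<in>Q. fst x \<le> cross (r - l) p \<and> cross (r - l) p \<le> fst x + D / 2 \<and>
             snd x \<le> cross p (t - a) \<and> cross p (t - a) \<le> snd x + D / 2" if "p \<in> set ps" for p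
          proof -
            from that obtain k where "k < n" "p = ps ! k" by (auto simp: in_set_conv_nth n_def)
            with cov[of k] pts[of k] show ?thesis by simp
          qed
          moreover have "fst l \<le> fst v \<and> fst v \<le> fst r \<and>
              cross (r - l) a \<le> cross (r - l) v \<and> cross (r - l) v \<le> cross (r - l) t" if "v \<in> set vs" for v
          proof -
            from that obtain k where "k < m" "v = V k" by (metis V in_set_conv_nth m_def)
            with chord(3) ij(3) show ?thesis by (simp add: a_def t_def)
          qed
          moreover have "l \<in> set vs" "r \<in> set vs" "a \<in> set vs" "t \<in> set vs"
            using chord(1,2) ij(1,2) V by (simp_all add: l_def r_def a_def t_def m_def)
          ultimately show ?case using Q unfolding square_cover_def D_def by blast
        qed
      qed (use un2 T in simp)
    qed (use un1 m in simp_all)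
  qed (use s m in simp_all)
  then show ?thesis by (simp only: T_def mult.assoc n_def m_def)
qed

section \<open>Nondegeneracy of the polygon and the ply bound\<close>

lemma convex_polygon_vertices:
  assumes "convex_polygon vs C"
  obtains x y z where "{x, y, z} \<subseteq> set vs" "\<not> collinear {x, y, z}"
proof -
  from assms have vs: "3 \<le> length vs" "distinct vs" "set vs = {v. v extreme_point_of C}"
    unfolding convex_polygon_def by blast+
  from vs(1) obtain x y z ws where "vs = x # y # z # ws"
    by (auto simp: numeral_3_eq_3 Suc_le_length_iff)
  with vs(2) have "x \<in> set vs" "y \<in> set vs" "z \<in> set vs" "distinct [x, y, z]"
    by simp_all
  moreover from this have "\<not> collinear {x, y, z}"
    unfolding vs(3) mem_Collect_eq by (rule not_collinear_extreme)
  ultimately show thesis by (intro that[of x y z]) simp_all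
qed

text \<open>A vanishing extent would put all vertices on one line, vertical or parallel to
  \<open>r - l\<close>.\<close>

lemma convex_polygon_nondegenerate:
  assumes C: "convex_polygon vs C"
    and l: "\<And>v. v \<in> set vs \<Longrightarrow> fst l \<le> fst v \<and> fst v \<le> fst r"
    and a: "\<And>v. v \<in> set vs \<Longrightarrow> cross (r - l) a \<le> cross (r - l) v \<and> cross (r - l) v \<le> cross (r - l) t"
  shows "0 < fst (r - l)" "0 < cross (r - l) (t - a)"
proof -
  obtain x y z where xyz: "{x, y, z} \<subseteq> set vs" "\<not> collinear {x, y, z}"
    using convex_polygon_vertices[OF C] .
  show 1: "0 < fst (r - l)"
  proof (rule ccontr)
    assume "\<not> 0 < fst (r - l)"
    \<comment> \<open>\<open>cross (0, 1) v\<close> is \<open>- fst v\<close>, so the level lines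
      are vertical.\<close>
    then have "cross (0, 1) v = - fst l" if "v \<in> {x, y, z}" for v
      using l[of v] xyz(1) that by (auto simp: cross_def)
    then have "collinear {x, y, z}" by (intro collinear_level[of "(0, 1)"]) (auto simp: zero_prod_def)
    with xyz(2) show False by simp
  qed
  show "0 < cross (r - l) (t - a)"
  proof (rule ccontr)
    assume "\<not> 0 < cross (r - l) (t - a)"
    then have "cross (r - l) v = cross (r - l) a" if "v \<in> {x, y, z}" for v
      using a[of v] xyz(1) that by (auto simp: cross_simps)
    moreover have "r - l \<noteq> 0" using 1 by auto
    ultimately have "collinear {x, y, z}" by (intro collinear_level[of "r - l" _ "cross (r - l) a"])
    with xyz(2) show False by simp
  qed
qed

text \<open>Parameters of translates through one point are more than \<open>cross u d / 2\<close>
  apart by separation and at most \<open>cross u d\<close> apart by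
  \<open>translation_vec_close\<close>.\<close>

lemma translations_ply_le_4:
  assumes Q: "finite Q" "separated (cross u d / 2) Q"
    and D: "0 < cross u d" "0 < fst u"
    and beta: "\<And>v w. v \<in> C \<Longrightarrow> w \<in> C \<Longrightarrow> cross u v - cross u w \<le> cross u d"
    and width: "\<And>v w. v \<in> C \<Longrightarrow> w \<in> C \<Longrightarrow> fst v - fst w \<le> fst u"
  shows "ply (translation C ` vec u d c (cross u d) ` Q) \<le> 4"
proof (rule ply_le)
  fix z
  define Z where "Z = {x \<in> Q. z \<in> translation C (vec u d c (cross u d) x)}"
  have fin: "finite Z" using Q(1) by (simp add: Z_def)
  have close: "fst x - fst y \<le> cross u d \<and> (fst x = fst y \<longrightarrow> snd x - snd y \<le> cross u d)"
    if "x \<in> Z" "y \<in> Z" for x y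
    using that by (intro translation_vec_close[where z = z and c = c, OF _ _ D beta width]) (simp_all add: Z_def)
  have "card Z \<le> 4"
  proof (rule card_le_4_separated[OF fin, of "cross u d / 2"])
    fix x y assume xy: "x \<in> Z" "y \<in> Z"
    then have "x \<in> Q" "y \<in> Q" by (simp_all add: Z_def)
    with Q(2) have sep: "fst x \<noteq> fst y \<Longrightarrow> cross u d / 2 < \<bar>fst x - fst y\<bar>"
      "fst x = fst y \<Longrightarrow> x \<noteq> y \<Longrightarrow> cross u d / 2 < \<bar>snd x - snd y\<bar>"
      unfolding separated_def by blast+
    show "fst x \<noteq> fst y \<Longrightarrow> cross u d / 2 < \<bar>fst x - fst y\<bar> \<and> \<bar>fst x - fst y\<bar> \<le> 2 * (cross u d / 2)"
      using sep(1) close[OF xy] close[OF xy(2,1)] by (simp add: abs_le_iff)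
    show "fst x = fst y \<Longrightarrow> x \<noteq> y \<Longrightarrow> cross u d / 2 < \<bar>snd x - snd y\<bar> \<and> \<bar>snd x - snd y\<bar> \<le> 2 * (cross u d / 2)"
      using sep(2) close[OF xy] close[OF xy(2,1)] by (simp add: abs_le_iff)
  qed
  \<comment> \<open>Sets are counted through their parameters: an image has at most as many elements
    as its source.\<close>
  moreover have "{S \<in> translation C ` vec u d c (cross u d) ` Q. z \<in> S} =
      (\<lambda>x. translation C (vec u d c (cross u d) x)) ` Z"
    by (auto simp: Z_def)
  then have "card {S \<in> translation C ` vec u d c (cross u d) ` Q. z \<in> S} \<le> card Z"
    using card_image_le[OF fin] by simp
  ultimately show "card {S \<in> translation C ` vec u d c (cross u d) ` Q. z \<in> S} \<le> 4"
    by simp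
qed

text \<open>Shows the cross product as a linear functional, so that \<open>hull_bounds\<close>
  applies.\<close>

lemma cross_eq_inner: "cross u x = inner (- snd u, fst u) x"
  by (simp add: cross_def inner_prod_def)

lemma fst_eq_inner: "fst x = inner (1, 0) (x :: point)"
  by (simp add: inner_prod_def)

lemma square_cover_ply:
  assumes C: "convex_polygon vs C" and S: "square_cover vs P S"
  shows "covers (translation C ` S) P \<and> ply (translation C ` S) \<le> 4"
proof -
  from S obtain l r a t Q where vs: "l \<in> set vs" "r \<in> set vs" "a \<in> set vs" "t \<in> set vs"
    and ext: "\<And>v. v \<in> set vs \<Longrightarrow> fst l \<le> fst v \<and> fst v \<le> fst r"
      "\<And>v. v \<in> set vs \<Longrightarrow> cross (r - l) a \<le> cross (r - l) v \<and> cross (r - l) v \<le> cross (r - l) t"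
    and Q: "finite Q" "separated (cross (r - l) (t - a) / 2) Q"
    and S: "S = vec (r - l) (t - a) ((1 / 2) *\<^sub>R (l + a)) (cross (r - l) (t - a)) ` Q"
    and cov: "\<And>p. p \<in> P \<Longrightarrow> \<exists>x\<in>Q. fst x \<le> cross (r - l) p \<and> cross (r - l) p \<le> fst x + cross (r - l) (t - a) / 2 \<and>
         snd x \<le> cross p (t - a) \<and> cross p (t - a) \<le> snd x + cross (r - l) (t - a) / 2"
    unfolding square_cover_def by blast
  have hull: "C = convex hull (set vs)" using C unfolding convex_polygon_def by blast
  then have in_C: "convex C" "l \<in> C" "r \<in> C" "a \<in> C" "t \<in> C"
    using vs by (simp_all add: hull_inc)
  note pos = convex_polygon_nondegenerate[OF C ext]
  have "fst l \<le> fst v \<and> fst v \<le> fst r" if "v \<in> C" for v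
    using hull_bounds[of "set vs" "fst l" "(1, 0)" "fst r" v] ext(1) that hull
    unfolding fst_eq_inner by blast
  then have width: "fst v - fst w \<le> fst (r - l)" if "v \<in> C" "w \<in> C" for v w
    using that by (simp add: diff_mono)
  have "cross (r - l) a \<le> cross (r - l) v \<and> cross (r - l) v \<le> cross (r - l) t" if "v \<in> C" for v
    using hull_bounds[of "set vs" "cross (r - l) a" "(- snd (r - l), fst (r - l))" "cross (r - l) t" v] ext(2) that hull
    unfolding cross_eq_inner by blast
  then have beta: "cross (r - l) v - cross (r - l) w \<le> cross (r - l) (t - a)" if "v \<in> C" "w \<in> C" for v w
    using that unfolding cross_simps(3) by (simp add: diff_mono)
  have ply: "ply (translation C ` S) \<le> 4"
    unfolding S by (rule translations_ply_le_4[OF Q pos(2,1) beta width])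
  have "covers (translation C ` S) P"
    unfolding covers_def
  proof
    fix p assume "p \<in> P"
    from cov[OF this] obtain x where x: "x \<in> Q" "fst x \<le> cross (r - l) p"
      "cross (r - l) p \<le> fst x + cross (r - l) (t - a) / 2"
      "snd x \<le> cross p (t - a)" "cross p (t - a) \<le> snd x + cross (r - l) (t - a) / 2" by blast
    from mem_translation_vec[OF in_C(1-3) in_C(4,5) pos(2) x(2-5)] x(1)
    show "p \<in> \<Union> (translation C ` S)" unfolding S by auto
  qed
  with ply show ?thesis by simp
qed

text \<open>For \<open>n \<ge> 1\<close>, \<open>R \<le> log 2 n + 1\<close> and
  \<open>n + 1 \<le> 2 * n\<close>; linear terms are absorbed by \<open>m * n\<close>, both factors
  being at least 1. This gives 2160 for \<open>n * log 2 n\<close> and 5520 for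
  \<open>m * n\<close>, both below 8000.\<close>

lemma time_bound:
  assumes n: "1 \<le> n" and m: "1 \<le> m"
    and t: "t \<le> 600 * (m + 1) + 1080 * (nat \<lceil>log 2 n\<rceil> + 1) * (n + 1)"
  shows "real t \<le> 8000 * (real n * log 2 n + real m * real n)"
proof -
  define R where "R = nat \<lceil>log 2 n\<rceil>"
  have log: "0 \<le> log 2 n" using n by simp
  then have "real R \<le> log 2 n + 1" unfolding R_def by linarith
  then have "real ((R + 1) * (n + 1)) \<le> (log 2 n + 2) * (2 * real n)"
    unfolding of_nat_mult using n log by (intro mult_mono) auto
  also have "\<dots> = 2 * (real n * log 2 n) + 4 * real n" by (simp add: algebra_simps)
  finally have 1: "real ((R + 1) * (n + 1)) \<le> 2 * (real n * log 2 n) + 4 * real n" .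
  have 2: "real n \<le> real m * real n" "real m \<le> real m * real n" using n m by simp_all
  have 3: "0 \<le> real n * log 2 n" using log by simp
  have "real t \<le> real (600 * (m + 1) + 1080 * ((R + 1) * (n + 1)))"
    using t by (simp only: of_nat_le_iff mult.assoc R_def)
  also have "\<dots> = 600 * (real m + 1) + 1080 * real ((R + 1) * (n + 1))"
    by simp
  also have "\<dots> \<le> 600 * (real m + real m) + 1080 * (2 * (real n * log 2 n) + 4 * real n)"
    using 1 m by (intro add_mono mult_left_mono) auto
  finally show ?thesis using 2 3 of_nat_0_le_iff[of n, where ?'a = real] unfolding distrib_left by linarith
qed

lemma le_power_ceiling_log: "n \<le> 2 ^ nat \<lceil>log 2 (real n)\<rceil>"
proof (cases "n = 0")
  case False
  then have "real n = 2 powr log 2 n" by simp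
  also have "\<dots> \<le> 2 powr real (nat \<lceil>log 2 n\<rceil>)"
    by (intro powr_mono) linarith+
  also have "\<dots> = real (2 ^ nat \<lceil>log 2 n\<rceil>)" by (simp add: powr_realpow)
  finally show ?thesis by (simp only: of_nat_le_iff)
qed simp

theorem theorem6:
  shows "\<exists>(A :: com) (c :: real).
    \<forall>(P :: point set) (n :: nat) (ps :: point list) (C :: point set) (m :: nat) (vs :: point list).
      finite P \<and> card P = n \<and> set ps = P \<and> distinct ps \<and>
      convex_polygon vs C \<and> length vs = m \<longrightarrow>
      (\<exists>t s. exec A (input_state ps vs) t s \<and>
         (1 \<le> n \<longrightarrow> real t \<le> c * (real n * log 2 (real n) + real m * real n)) \<and>
         covers (translation C ` output_vectors s) P \<and>
         ply (translation C ` output_vectors s) \<le> 4)"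
proof (intro exI[of _ cover_program] exI[of _ "8000 :: real"] allI impI, elim conjE)
  fix P :: "point set" and n m :: nat and ps vs :: "point list" and C :: "point set"
  assume P: "card P = n" "set ps = P" "distinct ps" and C: "convex_polygon vs C" "length vs = m"
  have n: "length ps = n" using P(1,2) distinct_card[OF P(3)] by simp
  have "3 \<le> m" using C unfolding convex_polygon_def by blast
  then have m: "vs \<noteq> []" "1 \<le> m" using C(2) by auto
  \<comment> \<open>The rounded-up logarithm serves as the bound \<open>R\<close> on the number of
    sorting passes.\<close>
  have "length ps \<le> 2 ^ nat \<lceil>log 2 (real n)\<rceil>" unfolding n by (rule le_power_ceiling_log)
  from cover_program_runs[OF m(1) this]
  obtain t s where ex: "exec cover_program (input_state ps vs) t s"
    and t: "t \<le> 600 * (m + 1) + 1080 * (nat \<lceil>log 2 n\<rceil> + 1) * (n + 1)"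
    and S: "square_cover vs P (output_vectors s)"
    unfolding runs_iff n C(2) P(2) by blast
  from ex time_bound[OF _ m(2) t] square_cover_ply[OF C(1) S]
  show "\<exists>t s. exec cover_program (input_state ps vs) t s \<and>
      (1 \<le> n \<longrightarrow> real t \<le> 8000 * (real n * log 2 (real n) + real m * real n)) \<and>
      covers (translation C ` output_vectors s) P \<and> ply (translation C ` output_vectors s) \<le> 4"
    by blast
qed

end
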